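(* Let $\{x^k\}$ be a sequence generated by the BPIREe algorithm with stepsizes and extrapolation parameters as in the context, and suppose that Assumptions 1, 2 and 3 of the context hold. Let $x^*$ be a limit point of $\{x^k\}$, suppose that $F$ satisfies the KL property at $x^*$, and suppose that for some $\rho>0$ and for each block $s_i$ the map $x\mapsto\nabla_{s_i}f(x)$ is Lipschitz continuous (with respect to the full variable $x$) on $B_{4\rho}(x^* )=\{x:\|x-x^*\|<4\rho\}$. Then $$\lim_{k\to+\infty}x^k=x^*.$$
   Context: Problem. Let $\{s_1,\dots,s_m\}$ be a partition of $\{1,\dots,n\}$ into disjoint blocks; $x_{s_i}$ is the subvector of $x\in\mathbb{R}^n$ indexed by $s_i$, $\nabla_{s_i}f$ the partial gradient with respect to $x_{s_i}$, and $(x_{\neq s_i},y_{s_i})$ is $x$ with block $s_i$ replaced by $y_{s_i}$. For $\lambda>0$ consider minimizing $F(x)=f(x)+\lambda\sum_{i=1}^m\sum_{j\in s_i}h(g(x_j))$ over $x\in\mathbb{R}^n$. Assumption 1. (i) $f:\mathbb{R}^n\to\mathbb{R}$ is continuously differentiable and, for each block, its partial gradient is Lipschitz in that block when the other blocks are fixed, with Lipschitz constants lying in $[\ell,L]$ for some $0<\ell\le L<\infty$. (ii) $g:\mathbb{R}\to\mathbb{R}$ is nonnegative, closed and convex. (iii) $h:\mathrm{Im}(g)\to\mathbb{R}_+$ is concave and differentiable, $h'(t)>0$ on $\mathrm{Im}(g)$, and $|h'(s)-h'(t)|\le L_h|s-t|$ for all $s,t\in\mathrm{Im}(g)$. (iv)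 $F$ is coercive: $F(x)\to+\infty$ as $\|x\|\to+\infty$. BPIREe algorithm. Start from $x^{-1}=x^0$. At iteration $k=1,2,\dots$ choose a block $b_k\in\{s_1,\dots,s_m\}$ (deterministically or randomly). Set $x^k_{s_i}=x^{k-1}_{s_i}$ if $s_i\ne b_k$, and for $s_i=b_k$ $$x^k_{s_i}=\arg\min_{x_{s_i}}\Big\{\langle\nabla_{s_i}f(x^{k-1}_{\neq s_i},\hat x^k_{s_i}),x_{s_i}\rangle+\tfrac1{2\alpha_k}\|x_{s_i}-\hat x^k_{s_i}\|^2+\sum_{j\in s_i}w^{k-1}_jg(x_j)\Big\},$$ where $w^{k-1}_j=\lambda h'(g(x^{k-1}_j))$, $\hat x^k_{s_i}=x^{k-1}_{s_i}+\beta_k(x^{k-1}_{s_i}-x^{\rm prev}_{s_i})$, $0\le\beta_k\le1$, and $x^{\rm prev}_{s_i}$ is the value of block $s_i$ just before its most recent update prior to iteration $k$ (equal to $x^0_{s_i}$ if block $s_i$ has not been updated before). Counting notation. $d^k_{s_i}$ is the number of iterations $\kappa\in\{1,\dots,k\}$ with $b_\kappa=s_i$. $\tilde x^j_{s_i}$ is the value of block $s_i$ after its $j$th update ($\tilde x^{-1}_{s_i}=\tilde x^0_{s_i}=x^0_{s_i}$), so $x^k_{s_i}=\tilde x^{d^k_{s_i}}_{s_i}$. $L_k\in[\ell,L]$ is a Lipschitz constant of $y\mapsto\nabla_{b_k}f(x^{k-1}_{\neq b_k},y)$. $\tilde L^j_{s_i},\tilde\beta^j_{s_i}$ denote $L_k,\beta_k$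 at the iteration $k$ at which block $s_i$ gets its $j$th update ($\tilde L^0_{s_i}$ is any fixed number in $[\ell,L]$). Parameters: $\alpha_k=\frac1{2L_k}$ and $\tilde\beta^j_{s_i}\le\frac\delta6\sqrt{\tilde L^{j-1}_{s_i}/\tilde L^j_{s_i}}$ for a fixed $\delta\in[0,1)$. Assumption 2 (essentially cyclic block update). There is an integer $T\ge m$ such that every block is updated at least once within any $T$ consecutive iterations. Assumption 3. For every $k\ge1$, $\beta_k$ is chosen so that $F(x^k)\le F(x^{k-1})$. KL property. $\partial$ denotes the limiting subdifferential. A proper closed $J$ has the Kurdyka-Łojasiewicz (KL) property at $\bar x\in\mathrm{dom}\,\partial J$ if there are a neighborhood $U$ of $\bar x$, $\xi\in(0,+\infty]$ and a concave function $\phi:[0,\xi)\to\mathbb{R}_+$, continuous at $0$, with $\phi(0)=0$, $\phi\in C^1(0,\xi)$, $\phi'>0$ on $(0,\xi)$, such that $\phi'(J(x)-J(\bar x))\,\mathrm{dist}(0,\partial J(x))\ge1$ for all $x\in U$ with $J(\bar x)<J(x)<J(\bar x)+\xi$. *)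

theory Defs
  imports "HOL-Analysis.Analysis"
begin

text \<open>
  The blocks are the members of a partition \<open>P\<close> of the finite index type \<open>'n\<close>. The
  subvector of \<open>x\<close> indexed by a block \<open>S\<close> is represented by its extension by zero, so the
  space of subvectors indexed by \<open>S\<close> is \<open>range (blk S)\<close>, with the norm and inner product
  inherited from the full space. With \<open>df\<close> the gradient of \<open>f\<close>, the partial gradient of
  \<open>f\<close> with respect to \<open>S\<close> is \<open>\<lambda>x. blk S (df x)\<close>.
\<close>

definition blk :: "'n set \<Rightarrow> real ^ 'n \<Rightarrow> real ^ 'n"
  where "blk S x = (\<chi> j. if j \<in> S then x $ j else 0)"

definition repl :: "'n set \<Rightarrow> real ^ 'n \<Rightarrow> real ^ 'n \<Rightarrow> real ^ 'n"
  where "repl S x y = (\<chi> j. if j \<in> S then y $ j else x $ j)"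

definition objective ::
  "'n::finite set set \<Rightarrow> (real ^ 'n \<Rightarrow> real) \<Rightarrow> (real \<Rightarrow> real) \<Rightarrow> (real \<Rightarrow> real) \<Rightarrow> real \<Rightarrow> real ^ 'n \<Rightarrow> real"
  where "objective P f g h lam x = f x + lam * (\<Sum>S\<in>P. \<Sum>j\<in>S. h (g (x $ j)))"

text \<open>\<open>c\<close> is a Lipschitz constant of the partial gradient in block \<open>S\<close> as a function of that
  block alone, the other blocks being fixed to those of \<open>x\<close>.\<close>

definition block_lipschitz ::
  "(real ^ 'n::finite \<Rightarrow> real ^ 'n) \<Rightarrow> 'n set \<Rightarrow> real ^ 'n \<Rightarrow> real \<Rightarrow> bool"
  where "block_lipschitz df S x c \<longleftrightarrow>
    c-lipschitz_on (range (blk S)) (\<lambda>y. blk S (df (repl S x y)))"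

definition smooth_assms ::
  "'n::finite set set \<Rightarrow> (real ^ 'n \<Rightarrow> real) \<Rightarrow> (real ^ 'n \<Rightarrow> real ^ 'n) \<Rightarrow> real \<Rightarrow> real \<Rightarrow> bool"
  where "smooth_assms P f df l L \<longleftrightarrow>
    (\<forall>x. GDERIV f x :> df x) \<and> continuous_on UNIV df \<and>
    0 < l \<and> l \<le> L \<and>
    (\<forall>S\<in>P. \<forall>x. \<exists>c\<in>{l..L}. block_lipschitz df S x c)"

definition inner_assms :: "(real \<Rightarrow> real) \<Rightarrow> bool"
  where "inner_assms g \<longleftrightarrow> (\<forall>t. 0 \<le> g t) \<and> closed (epigraph UNIV g) \<and> convex_on UNIV g"

text \<open>\<open>h\<close> only matters on the interval \<open>range g\<close>; at an endpoint belonging to it, the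
  derivative \<open>dh\<close> is one-sided.\<close>

definition outer_assms ::
  "(real \<Rightarrow> real) \<Rightarrow> (real \<Rightarrow> real) \<Rightarrow> (real \<Rightarrow> real) \<Rightarrow> real \<Rightarrow> bool"
  where "outer_assms g h dh Lh \<longleftrightarrow>
    (\<forall>t\<in>range g. 0 \<le> h t) \<and> concave_on (range g) h \<and>
    (\<forall>t\<in>range g. (h has_real_derivative dh t) (at t within range g)) \<and>
    (\<forall>t\<in>range g. 0 < dh t) \<and>
    (\<forall>s\<in>range g. \<forall>t\<in>range g. \<bar>dh s - dh t\<bar> \<le> Lh * \<bar>s - t\<bar>)"

definition coercive :: "(real ^ 'n::finite \<Rightarrow> real) \<Rightarrow> bool"
  where "coercive F \<longleftrightarrow> filterlim F at_top at_infinity"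

text \<open>The iterate just before the most recent update of block \<open>S\<close> prior to iteration \<open>k\<close>;
  only its block \<open>S\<close> is used.\<close>

definition prev_iterate :: "(nat \<Rightarrow> 'n set) \<Rightarrow> (nat \<Rightarrow> 'a) \<Rightarrow> 'n set \<Rightarrow> nat \<Rightarrow> 'a"
  where "prev_iterate b x S k =
    (let K = {i \<in> {1..<k}. b i = S} in if K = {} then x 0 else x (Max K - 1))"

definition extrapolated ::
  "(nat \<Rightarrow> real) \<Rightarrow> (nat \<Rightarrow> 'n set) \<Rightarrow> (nat \<Rightarrow> real ^ 'n) \<Rightarrow> 'n::finite set \<Rightarrow> nat \<Rightarrow> real ^ 'n"
  where "extrapolated \<beta> b x S k =
    blk S (x (k - 1)) + \<beta> k *\<^sub>R (blk S (x (k - 1)) - blk S (prev_iterate b x S k))"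

definition bpiree ::
  "'n::finite set set \<Rightarrow> (real ^ 'n \<Rightarrow> real ^ 'n) \<Rightarrow> (real \<Rightarrow> real) \<Rightarrow> (real \<Rightarrow> real) \<Rightarrow> real \<Rightarrow>
   (nat \<Rightarrow> real) \<Rightarrow> (nat \<Rightarrow> real) \<Rightarrow> (nat \<Rightarrow> 'n set) \<Rightarrow> (nat \<Rightarrow> real ^ 'n) \<Rightarrow> bool"
  where "bpiree P df g dh lam \<alpha> \<beta> b x \<longleftrightarrow>
    (\<forall>k\<ge>1. b k \<in> P \<and> 0 \<le> \<beta> k \<and> \<beta> k \<le> 1 \<and>
      (\<forall>S\<in>P. S \<noteq> b k \<longrightarrow> blk S (x k) = blk S (x (k - 1))) \<and>
      (let S = b k; xh = extrapolated \<beta> b x S k in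
        is_arg_min
          (\<lambda>y. blk S (df (repl S (x (k - 1)) xh)) \<bullet> y
            + 1 / (2 * \<alpha> k) * (norm (y - xh))\<^sup>2
            + (\<Sum>j\<in>S. lam * dh (g (x (k - 1) $ j)) * g (y $ j)))
          (\<lambda>y. y \<in> range (blk S)) (blk S (x k))))"

definition update_count :: "(nat \<Rightarrow> 'n set) \<Rightarrow> 'n set \<Rightarrow> nat \<Rightarrow> nat"
  where "update_count b S k = card {i \<in> {1..k}. b i = S}"

text \<open>The iteration at which block \<open>S\<close> gets its \<open>j\<close>th update, for \<open>j \<ge> 1\<close>.\<close>

definition update_time :: "(nat \<Rightarrow> 'n set) \<Rightarrow> 'n set \<Rightarrow> nat \<Rightarrow> nat"
  where "update_time b S j = (LEAST k. update_count b S k = j)"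

definition tilde_beta :: "(nat \<Rightarrow> real) \<Rightarrow> (nat \<Rightarrow> 'n set) \<Rightarrow> 'n set \<Rightarrow> nat \<Rightarrow> real"
  where "tilde_beta \<beta> b S j = \<beta> (update_time b S j)"

definition tilde_L ::
  "('n set \<Rightarrow> real) \<Rightarrow> (nat \<Rightarrow> real) \<Rightarrow> (nat \<Rightarrow> 'n set) \<Rightarrow> 'n set \<Rightarrow> nat \<Rightarrow> real"
  where "tilde_L L0 Lk b S j = (if j = 0 then L0 S else Lk (update_time b S j))"

definition parameter_rule ::
  "'n::finite set set \<Rightarrow> (real ^ 'n \<Rightarrow> real ^ 'n) \<Rightarrow> real \<Rightarrow> real \<Rightarrow> real \<Rightarrow> ('n set \<Rightarrow> real) \<Rightarrow>
   (nat \<Rightarrow> real) \<Rightarrow> (nat \<Rightarrow> real) \<Rightarrow> (nat \<Rightarrow> real) \<Rightarrow> (nat \<Rightarrow> 'n set) \<Rightarrow> (nat \<Rightarrow> real ^ 'n) \<Rightarrow> bool"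
  where "parameter_rule P df l L \<delta> L0 Lk \<alpha> \<beta> b x \<longleftrightarrow>
    0 \<le> \<delta> \<and> \<delta> < 1 \<and>
    (\<forall>S\<in>P. L0 S \<in> {l..L}) \<and>
    (\<forall>k\<ge>1. Lk k \<in> {l..L} \<and> block_lipschitz df (b k) (x (k - 1)) (Lk k) \<and> \<alpha> k = 1 / (2 * Lk k)) \<and>
    (\<forall>S\<in>P. \<forall>j\<ge>1. tilde_beta \<beta> b S j
        \<le> \<delta> / 6 * sqrt (tilde_L L0 Lk b S (j - 1) / tilde_L L0 Lk b S j))"

definition essentially_cyclic :: "'n set set \<Rightarrow> (nat \<Rightarrow> 'n set) \<Rightarrow> bool"
  where "essentially_cyclic P b \<longleftrightarrow>
    (\<exists>T\<ge>card P. \<forall>S\<in>P. \<forall>k\<ge>1. \<exists>i\<in>{k..<k + T}. b i = S)"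

text \<open>Subdifferentials and the KL property are given for functions that are finite everywhere,
  for which the effective domain is the whole space.\<close>

definition frechet_subdiff :: "(real ^ 'n::finite \<Rightarrow> real) \<Rightarrow> real ^ 'n \<Rightarrow> (real ^ 'n) set"
  where "frechet_subdiff J x =
    {v. 0 \<le> Liminf (at x) (\<lambda>y. ereal ((J y - J x - v \<bullet> (y - x)) / norm (y - x)))}"

definition limiting_subdiff :: "(real ^ 'n::finite \<Rightarrow> real) \<Rightarrow> real ^ 'n \<Rightarrow> (real ^ 'n) set"
  where "limiting_subdiff J x =
    {v. \<exists>z u. z \<longlonglongrightarrow> x \<and> (\<lambda>k. J (z k)) \<longlonglongrightarrow> J x \<and>
         (\<forall>k. u k \<in> frechet_subdiff J (z k)) \<and> u \<longlonglongrightarrow> v}"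

text \<open>The distance to the limiting subdifferential is taken in the extended reals, because
  the distance to the empty set is \<open>\<infinity>\<close> here, whereas \<^const>\<open>infdist\<close> gives \<open>0\<close>.\<close>

definition KL_property :: "(real ^ 'n::finite \<Rightarrow> real) \<Rightarrow> real ^ 'n \<Rightarrow> bool"
  where "KL_property J xb \<longleftrightarrow>
    closed (epigraph UNIV J) \<and> limiting_subdiff J xb \<noteq> {} \<and>
    (\<exists>U (\<xi>::ereal) (\<phi>::real \<Rightarrow> real) \<phi>'. open U \<and> xb \<in> U \<and> 0 < \<xi> \<and>
      (\<forall>t. 0 \<le> t \<and> ereal t < \<xi> \<longrightarrow> 0 \<le> \<phi> t) \<and>
      concave_on {t. 0 \<le> t \<and> ereal t < \<xi>} \<phi> \<and>
      continuous (at 0 within {t. 0 \<le> t \<and> ereal t < \<xi>}) \<phi> \<and>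
      \<phi> 0 = 0 \<and>
      (\<forall>t. 0 < t \<and> ereal t < \<xi> \<longrightarrow> (\<phi> has_real_derivative \<phi>' t) (at t)) \<and>
      continuous_on {t. 0 < t \<and> ereal t < \<xi>} \<phi>' \<and>
      (\<forall>t. 0 < t \<and> ereal t < \<xi> \<longrightarrow> 0 < \<phi>' t) \<and>
      (\<forall>x\<in>U. J xb < J x \<and> ereal (J x) < ereal (J xb) + \<xi> \<longrightarrow>
        1 \<le> ereal (\<phi>' (J x - J xb)) * (INF v\<in>limiting_subdiff J x. ereal (dist 0 v))))"

end

theory Submission
  imports Defs
begin

text \<open>
  Each update after time \<open>T\<close> decreases \<open>F\<close> by a multiple of the squared step length, up to an error that
  comes from the extrapolation and that involves only the previous step of the same block. With
  \<open>e i = Lk i * (norm (x i - x (i - 1)))\<^sup>2\<close> the estimate is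
  \<open>F (x i) \<le> F (x (i - 1)) - 5/4 * e i + 1/4 * e (prior i)\<close> (\<open>step_decrease\<close>); it combines the
  descent lemma for \<open>f\<close>, the tangent inequality for the concave \<open>h\<close> and the first-order optimality
  of the proximal step. The previous step of the same block lies at most \<open>T\<close> iterations back, and
  distinct iterations have distinct predecessors. Hence, if time is divided into windows of length
  \<open>T\<close> and \<open>a n\<close> is the square root of the sum of \<open>e\<close> over the \<open>n\<close>th window, then
  \<open>(a (n + 1))\<^sup>2 \<le> F (x ((n + 1) * T)) - F (x ((n + 2) * T)) + (a n)\<^sup>2 / 4\<close>
  (\<open>window_decrease\<close>). As \<open>F (x k)\<close> decreases to \<open>F xs\<close>, this already gives \<open>a n \<longlonglongrightarrow> 0\<close>.

  The optimality condition of the last update of each block supplies a subgradient of the convex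
  function \<open>g\<close> at every coordinate of the current iterate. Together they form a subgradient of \<open>F\<close>,
  because \<open>h\<close> is increasing and differentiable. Near \<open>xs\<close> its norm is at most a constant times the
  length of the path travelled during the last two windows (\<open>small_subgradient\<close>), hence at most
  \<open>K * (a (n + 1) + a n)\<close> at time \<open>(n + 2) * T\<close>. With the gap \<open>D n = F (x (n * T)) - F xs\<close>, the KL
  inequality and the concavity of the desingularizing function \<open>\<phi>\<close> turn this into
  \<open>D (n + 2) - D (n + 3) \<le> K * (a (n + 1) + a n) * (\<phi> (D (n + 2)) - \<phi> (D (n + 3)))\<close>.
  Inserted in the window estimate, and after taking square roots, this becomes
  \<open>a (n + 2) \<le> 5/8 * a (n + 1) + 1/8 * a n + 2 * K * (\<phi> (D (n + 2)) - \<phi> (D (n + 3)))\<close>.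

  The coefficients of \<open>a\<close> add up to \<open>3/4 < 1\<close>, so a quantity made of the distance to \<open>xs\<close>, of the last two
  values of \<open>a\<close> and of \<open>\<phi> (D n)\<close> decreases as long as the iterates stay in the neighbourhood of
  \<open>xs\<close> in which all estimates are available. At some iterate near the limit point it is so small
  that the iterates can never leave this neighbourhood, and convergence follows
  (\<open>tendsto_of_two_step_recursion\<close>).
\<close>

section \<open>Sequences controlled by a two-step recursion\<close>

text \<open>
  The recursion is only available while \<open>y\<close> is close to \<open>z\<close>, so the summability of \<open>a\<close> and the fact
  that \<open>y\<close> stays close to \<open>z\<close> have to be obtained together. The coefficients of \<open>V\<close> below are chosen
  such that the recursion reads \<open>V (n + 1) + a (n + 2) / 4 \<le> V n\<close>. Adding \<open>4 * c\<close> times \<open>V\<close> to the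
  distance from \<open>z\<close> therefore pays for the movement \<open>c * a (n + 2)\<close> of \<open>y\<close>, and the sum \<open>W\<close>
  decreases as long as it is below \<open>r\<close>. It is small at some late time because \<open>z\<close> is a cluster point,
  and then it stays small.
\<close>

lemma tendsto_of_two_step_recursion:
  fixes y :: "nat \<Rightarrow> 'a::metric_space" and a \<psi> :: "nat \<Rightarrow> real"
  assumes a_nonneg: "\<And>n. 0 \<le> a n" and a_lim: "a \<longlonglongrightarrow> 0"
    and psi_nonneg: "\<forall>\<^sub>F n in sequentially. 0 \<le> \<psi> n" and psi_lim: "\<psi> \<longlonglongrightarrow> 0"
    and c: "0 \<le> c" and step: "\<And>n. dist (y (Suc n)) (y n) \<le> c * a n"
    and r: "0 < r"
    and rec: "\<forall>\<^sub>F n in sequentially. dist (y (n+2)) z < r \<longrightarrow>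
      a (n+2) \<le> 5/8 * a (n+1) + 1/8 * a n + \<psi> (n+2) - \<psi> (n+3)"
    and cluster: "\<And>e. 0 < e \<Longrightarrow> \<exists>\<^sub>F n in sequentially. dist (y n) z < e"
  shows "y \<longlonglongrightarrow> z"
proof -
  define V where "V n = \<psi> (n+2) + 3/4 * a (n+1) + 1/8 * a n" for n
  define W where "W n = dist (y (n+2)) z + 4 * c * V n" for n
  have "V \<longlonglongrightarrow> 0 + 3/4 * 0 + 1/8 * 0"
    unfolding V_def by (intro tendsto_intros a_lim LIMSEQ_ignore_initial_segment psi_lim)
  hence "(\<lambda>n. 4 * c * V n) \<longlonglongrightarrow> 4 * c * 0" by (intro tendsto_mult_left) simp
  hence V_small: "\<forall>\<^sub>F n in sequentially. 4 * c * V n < e" if "0 < e" for e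
    using that by (auto dest: order_tendstoD(2))
  have V_nonneg: "\<forall>\<^sub>F n in sequentially. 0 \<le> V n"
    using eventually_sequentially_seg[THEN iffD2, OF psi_nonneg, of 2]
    by eventually_elim (use a_nonneg in \<open>simp add: V_def\<close>)
  obtain N where N: "\<And>n. n \<ge> N \<Longrightarrow> 0 \<le> V n"
    and N_rec: "\<And>n. n \<ge> N \<Longrightarrow> dist (y (n+2)) z < r \<Longrightarrow>
      a (n+2) \<le> 5/8 * a (n+1) + 1/8 * a n + \<psi> (n+2) - \<psi> (n+3)"
    using eventually_conj[OF V_nonneg rec] unfolding eventually_sequentially by blast
  have dist_le: "dist (y (n+2)) z \<le> W n" if "n \<ge> N" for n
    using N[OF that] c by (simp add: W_def)
  have W_decr: "W (Suc n) \<le> W n" if n: "n \<ge> N" and "W n < r" for n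
  proof -
    have near: "dist (y (n+2)) z < r"
      using dist_le[OF n] \<open>W n < r\<close> by simp
    have "V (Suc n) + 1/4 * a (n+2) \<le> V n"
      using N_rec[OF n near] by (simp add: V_def eval_nat_numeral)
    hence "4 * c * (V (Suc n) + 1/4 * a (n+2)) \<le> 4 * c * V n"
      using c by (intro mult_left_mono) auto
    moreover have "dist (y (Suc n + 2)) z \<le> c * a (n+2) + dist (y (n+2)) z"
      using dist_triangle[of "y (Suc n + 2)" z "y (n+2)"] step[of "n+2"] by simp
    ultimately show ?thesis by (simp add: W_def algebra_simps)
  qed
  show ?thesis
  proof (rule metric_LIMSEQ_I)
    fix e :: real assume "0 < e"
    define e' where "e' = min e r"
    have e': "0 < e'" "e' \<le> e" "e' \<le> r" using \<open>0 < e\<close> r by (auto simp: e'_def)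
    obtain N1 where N1: "\<And>n. n \<ge> N1 \<Longrightarrow> 4 * c * V n < e'/2"
      using V_small[of "e'/2"] e' unfolding eventually_sequentially by auto
    obtain m where m: "m \<ge> max N N1 + 2" "dist (y m) z < e'/2"
      using cluster[of "e'/2"] e' unfolding frequently_sequentially by auto
    have W_small: "W n < e'" if "n \<ge> m - 2" for n
      using that
    proof (induction n rule: dec_induct)
      case base
      have "m - 2 + 2 = m" using m by simp
      moreover have "4 * c * V (m - 2) < e'/2" using m by (intro N1) simp
      ultimately show ?case using m(2) unfolding W_def by simp
    next
      case (step n)
      have "n \<ge> N" "W n < r" using step m e' by auto
      from W_decr[OF this] show ?case using step by simp
    qed
    have "dist (y n) z < e" if "n \<ge> m" for n
    proof -
      have "n - 2 \<ge> N" "n - 2 \<ge> m - 2" "n - 2 + 2 = n" using that m by auto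
      thus ?thesis using dist_le[of "n - 2"] W_small[of "n - 2"] e' by simp
    qed
    thus "\<exists>no. \<forall>n\<ge>no. dist (y n) z < e" by blast
  qed
qed

text \<open>
  The second assumption is used through the inequality of arithmetic and geometric means, with the
  weights arranged so that \<open>a1\<close> and \<open>a2\<close> are each charged only \<open>1/8\<close>. With the \<open>1/2\<close> that comes
  from \<open>a1\<^sup>2 / 4\<close> this leaves a total of \<open>3/4\<close>; any total below \<open>1\<close> would give a convergent recursion.
\<close>

lemma two_step_bound_of_squares:
  fixes a a1 a2 D C s :: real
  assumes "a\<^sup>2 \<le> D + a1\<^sup>2 / 4" "D \<le> C * (a1 + a2) * s"
    and nonneg: "0 \<le> a1" "0 \<le> a2" "0 \<le> C" "0 \<le> s"
  shows "a \<le> 5/8 * a1 + 1/8 * a2 + 2 * C * s"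
proof (rule power2_le_imp_le)
  let ?p = "(a1 + a2) / 8" and ?q = "2 * C * s"
  have pos: "0 \<le> ?p" "0 \<le> ?q" using nonneg by auto
  have "a\<^sup>2 \<le> a1\<^sup>2 / 4 + 4 * ?p * ?q"
    using assms(1,2) by (simp add: field_simps)
  also have "\<dots> \<le> a1\<^sup>2 / 4 + (?p + ?q)\<^sup>2"
  proof -
    have "4 * p * q \<le> (p + q)\<^sup>2" for p q :: real
      using sum_squares_bound[of p q] by (simp add: power2_sum)
    thus ?thesis by (rule add_left_mono)
  qed
  also have "\<dots> \<le> (a1 / 2 + (?p + ?q))\<^sup>2"
  proof -
    have "0 \<le> a1 * (?p + ?q)" using nonneg pos by (intro mult_nonneg_nonneg add_nonneg_nonneg) auto
    thus ?thesis
      using power2_sum[of "a1 / 2" "?p + ?q"] zero_le_power2[of a1] by (simp add: power_divide)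
  qed
  also have "a1 / 2 + (?p + ?q) = 5/8 * a1 + 1/8 * a2 + 2 * C * s" by (simp add: field_simps)
  finally show "a\<^sup>2 \<le> (5/8 * a1 + 1/8 * a2 + 2 * C * s)\<^sup>2" .
  show "0 \<le> 5/8 * a1 + 1/8 * a2 + 2 * C * s" using nonneg by (intro add_nonneg_nonneg mult_nonneg_nonneg) auto
qed

text \<open>
  The quantity \<open>V\<close> is nonincreasing and bounded below, and it drops by at least half the square of
  \<open>a\<close> in each step.
\<close>

lemma tendsto_zero_of_contracting_squares:
  fixes a D :: "nat \<Rightarrow> real"
  assumes ineq: "\<And>n. (a (Suc n))\<^sup>2 \<le> D (Suc n) - D (Suc (Suc n)) + (a n)\<^sup>2 / 4"
    and D: "D \<longlonglongrightarrow> d" and D_ge: "\<And>n. d \<le> D n"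
  shows "a \<longlonglongrightarrow> 0"
proof -
  define V where "V n = D (Suc n) + (a n)\<^sup>2 / 2" for n
  have V_step: "V (Suc n) + (a (Suc n))\<^sup>2 / 2 \<le> V n" for n
    using ineq[of n] zero_le_power2[of "a n"] unfolding V_def by linarith
  have "decseq V"
  proof (rule decseq_SucI)
    show "V (Suc n) \<le> V n" for n
      using V_step[of n] zero_le_power2[of "a (Suc n)"] by linarith
  qed
  moreover have "d \<le> V n" for n
    using D_ge[of "Suc n"] zero_le_power2[of "a n"] unfolding V_def by linarith
  ultimately obtain v where v: "V \<longlonglongrightarrow> v"
    using decseq_convergent[of V d] by blast
  have lim: "(\<lambda>n. 2 * (V n - V (Suc n))) \<longlonglongrightarrow> 2 * (v - v)"
    by (intro tendsto_intros v LIMSEQ_Suc)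
  have "(\<lambda>n. (a (Suc n))\<^sup>2) \<longlonglongrightarrow> 0"
  proof (rule tendsto_sandwich[OF _ _ tendsto_const])
    show "(\<lambda>n. 2 * (V n - V (Suc n))) \<longlonglongrightarrow> 0" using lim by simp
    show "\<forall>\<^sub>F n in sequentially. (a (Suc n))\<^sup>2 \<le> 2 * (V n - V (Suc n))"
    proof (rule always_eventually, rule allI)
      show "(a (Suc n))\<^sup>2 \<le> 2 * (V n - V (Suc n))" for n using V_step[of n] by (simp add: algebra_simps)
    qed
  qed simp
  hence "(\<lambda>n. a (Suc n)) \<longlonglongrightarrow> 0" by (simp add: tendsto_null_power)
  thus ?thesis by (rule LIMSEQ_imp_Suc)
qed

lemma decseq_LIMSEQ_of_subseq:
  fixes X :: "nat \<Rightarrow> real"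
  assumes X: "decseq X" and r: "strict_mono r" and lim: "(X \<circ> r) \<longlonglongrightarrow> c"
  shows "X \<longlonglongrightarrow> c" and "\<And>n. c \<le> X n"
proof -
  have bound: "c \<le> X n" for n
  proof (rule LIMSEQ_le_const2[OF lim])
    show "\<exists>N. \<forall>m\<ge>N. (X \<circ> r) m \<le> X n"
      using X r by (metis comp_apply decseqD order_trans seq_suble)
  qed
  then obtain d where d: "X \<longlonglongrightarrow> d" using decseq_convergent[OF X] by blast
  hence "d = c" using LIMSEQ_subseq_LIMSEQ[OF d r] lim LIMSEQ_unique by blast
  with d show "X \<longlonglongrightarrow> c" by simp
  show "\<And>n. c \<le> X n" by (rule bound)
qed

lemma sum_pullback_le_of_inj_on:
  fixes u :: "'a \<Rightarrow> real"
  assumes "finite B" "inj_on p A" "p ` A \<subseteq> B" "\<And>i. i \<in> B \<Longrightarrow> 0 \<le> u i"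
  shows "(\<Sum>i\<in>A. u (p i)) \<le> sum u B"
proof -
  have "(\<Sum>i\<in>A. u (p i)) = sum u (p ` A)"
    using assms(2) by (simp add: sum.reindex)
  also have "\<dots> \<le> sum u B" using assms by (intro sum_mono2) auto
  finally show ?thesis .
qed

section \<open>Convex and concave functions of one variable\<close>

text \<open>
  The base point may be an endpoint of \<open>S\<close>, where the derivative is one-sided. This is needed for
  \<open>h\<close> at the minimum of \<open>g\<close>. The difference quotient along the segment from \<open>s\<close> to \<open>t\<close> is bounded
  below by the secant slope.
\<close>

lemma concave_on_imp_below_tangent_within:
  fixes f :: "real \<Rightarrow> real"
  assumes concave: "concave_on S f" and S: "s \<in> S" "t \<in> S"
    and deriv: "(f has_real_derivative D) (at s within S)"
  shows "f t \<le> f s + D * (t - s)"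
proof -
  have "((\<lambda>\<theta>. f (s + \<theta> * (t - s))) has_real_derivative D * (t - s)) (at 0 within {0..1})"
  proof -
    have conv: "convex S" using concave by (simp add: concave_on_iff)
    have sub: "(\<lambda>\<theta>. s + \<theta> * (t - s)) ` {0..1} \<subseteq> S"
    proof safe
      fix \<theta> :: real assume "\<theta> \<in> {0..1}"
      thus "s + \<theta> * (t - s) \<in> S"
        using convexD[OF conv S, of "1 - \<theta>" \<theta>] by (simp add: algebra_simps)
    qed
    have d: "(f has_real_derivative D) (at (s + 0 * (t - s)) within (\<lambda>\<theta>. s + \<theta> * (t - s)) ` {0..1})"
      using DERIV_subset[OF deriv sub] by simp
    have e: "((\<lambda>\<theta>. s + \<theta> * (t - s)) has_real_derivative (t - s)) (at 0 within {0..1})"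
      by (auto intro!: derivative_eq_intros)
    show ?thesis using DERIV_image_chain[OF d e] by (simp add: o_def)
  qed
  hence lim: "((\<lambda>\<theta>. (f (s + \<theta> * (t - s)) - f s) / \<theta>) \<longlongrightarrow> D * (t - s)) (at 0 within {0..1})"
    by (simp add: has_field_derivative_iff)
  have ge: "\<forall>\<^sub>F \<theta> in at 0 within {0..1}. f t - f s \<le> (f (s + \<theta> * (t - s)) - f s) / \<theta>"
    unfolding eventually_at_filter
  proof (rule always_eventually, intro allI impI)
    fix \<theta> :: real assume "\<theta> \<noteq> 0" and "\<theta> \<in> {0..1}"
    hence t: "0 < \<theta>" "\<theta> \<le> 1" by auto
    have "(1 - \<theta>) * f s + \<theta> * f t \<le> f ((1 - \<theta>) *\<^sub>R s + \<theta> *\<^sub>R t)"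
      using concave S t unfolding concave_on_iff by auto
    also have "(1 - \<theta>) *\<^sub>R s + \<theta> *\<^sub>R t = s + \<theta> * (t - s)" by (simp add: algebra_simps)
    finally show "f t - f s \<le> (f (s + \<theta> * (t - s)) - f s) / \<theta>"
      using t by (simp add: field_simps)
  qed
  have "f t - f s \<le> D * (t - s)"
    by (rule tendsto_lowerbound[OF lim ge]) (simp add: trivial_limit_within islimpt_Icc)
  thus ?thesis by simp
qed

text \<open>
  A slope of \<open>g\<close> at a point of \<open>[-R, R]\<close> is dominated by the increment of \<open>g\<close> over the adjacent
  interval of length \<open>1\<close>. As \<open>g\<close> is nonnegative, this increment is at most the maximum of \<open>g\<close> on
  \<open>[-(R + 1), R + 1]\<close>. The same bound serves for Lipschitz constants and for subgradients.
\<close>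

lemma nonneg_convex_locally_lipschitz:
  fixes g :: "real \<Rightarrow> real"
  assumes convex: "convex_on UNIV g" and nonneg: "\<And>t. 0 \<le> g t" and R: "0 \<le> R"
  obtains M where "0 \<le> M"
    and "\<And>u v. \<bar>u\<bar> \<le> R \<Longrightarrow> \<bar>v\<bar> \<le> R \<Longrightarrow> \<bar>g u - g v\<bar> \<le> M * \<bar>u - v\<bar>"
    and "\<And>u \<nu>. \<bar>u\<bar> \<le> R \<Longrightarrow> (\<And>t. g u + \<nu> * (t - u) \<le> g t) \<Longrightarrow> \<bar>\<nu>\<bar> \<le> M"
proof -
  have "continuous_on {-(R+1)..R+1} g"
    using convex_on_continuous[OF open_UNIV convex] continuous_on_subset by blast
  moreover have "{-(R+1)..R+1} \<noteq> {}" using R by simp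
  ultimately obtain u0 where u0: "\<And>u. u \<in> {-(R+1)..R+1} \<Longrightarrow> g u \<le> g u0"
    using continuous_attains_sup[OF compact_Icc] by blast
  define M where "M = g u0"
  have g_le: "g u \<le> M" if "\<bar>u\<bar> \<le> R + 1" for u
    using u0[of u] that by (simp add: M_def abs_le_iff)
  have M: "0 \<le> M" using nonneg by (simp add: M_def)
  have bound: "\<bar>g u - g v\<bar> \<le> M * \<bar>u - v\<bar>" if "u < v" "\<bar>u\<bar> \<le> R" "\<bar>v\<bar> \<le> R" for u v
  proof -
    have "(g u - g v) / (u - v) \<le> (g v - g (v+1)) / (v - (v+1))"
      using convex_on_slope_le[OF convex, of u "v+1" v] that by simp
    moreover have "g (v+1) \<le> M" using that by (intro g_le) linarith
    ultimately have up: "(g u - g v) / (u - v) \<le> M" using nonneg[of v] by simp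
    have "(g (u-1) - g u) / ((u-1) - u) \<le> (g u - g v) / (u - v)"
      using convex_on_slope_le[OF convex, of "u-1" v u] that by simp
    moreover have "g (u-1) \<le> M" using that by (intro g_le) linarith
    ultimately have lo: "- M \<le> (g u - g v) / (u - v)" using nonneg[of u] by simp
    have "\<bar>(g u - g v) / (u - v)\<bar> \<le> M" using up lo by linarith
    hence "\<bar>g u - g v\<bar> / \<bar>u - v\<bar> \<le> M" by (simp only: abs_divide[symmetric])
    thus ?thesis using \<open>u < v\<close> by (simp only: pos_divide_le_eq zero_less_abs_iff)
  qed
  have lip: "\<bar>g u - g v\<bar> \<le> M * \<bar>u - v\<bar>" if "\<bar>u\<bar> \<le> R" "\<bar>v\<bar> \<le> R" for u v
    using bound[of u v] bound[of v u] that
    by (cases u v rule: linorder_cases) (simp_all add: abs_minus_commute)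
  have sub: "\<bar>\<nu>\<bar> \<le> M" if "\<bar>u\<bar> \<le> R" "\<And>t. g u + \<nu> * (t - u) \<le> g t" for u \<nu>
  proof -
    have "g (u+1) \<le> M" "g (u-1) \<le> M" using that(1) by (intro g_le; linarith)+
    thus ?thesis using that(2)[of "u+1"] that(2)[of "u-1"] nonneg[of u] by simp
  qed
  show thesis by (rule that[OF M lip sub])
qed

text \<open>
  The chain rule for the Frechet subgradient of \<open>h \<circ> g\<close>: the first-order expansion of \<open>h\<close> is
  monotone in its argument since \<open>0 \<le> D\<close>, so the subgradient inequality of \<open>g\<close> can be inserted, and
  its remainder is of first order in \<open>t - s\<close> because \<open>g\<close> is locally Lipschitz.
\<close>

lemma scalar_composite_lower_expansion:
  fixes g h :: "real \<Rightarrow> real"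
  assumes convex: "convex_on UNIV g" and nonneg: "\<And>t. 0 \<le> g t"
    and sub: "\<And>t. g s + \<nu> * (t - s) \<le> g t"
    and deriv: "(h has_real_derivative D) (at (g s) within range g)" and "0 \<le> D" and "0 < e"
  shows "\<forall>\<^sub>F t in nhds s. h (g s) + D * \<nu> * (t - s) - e * \<bar>t - s\<bar> \<le> h (g t)"
proof -
  obtain M where M: "0 \<le> M"
    and lip: "\<And>u v. \<bar>u\<bar> \<le> \<bar>s\<bar> + 1 \<Longrightarrow> \<bar>v\<bar> \<le> \<bar>s\<bar> + 1 \<Longrightarrow> \<bar>g u - g v\<bar> \<le> M * \<bar>u - v\<bar>"
    by (rule nonneg_convex_locally_lipschitz[OF convex nonneg, of "\<bar>s\<bar> + 1"]) (simp, rule that)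
  define e' where "e' = e / (M + 1)"
  have e': "0 < e'" using \<open>0 < e\<close> M by (simp add: e'_def)
  have "e' * (M + 1) = e" using M by (simp add: e'_def)
  hence e'_M: "e' * M \<le> e" using e' by (simp add: distrib_left)
  have "\<forall>\<^sub>F u in at (g s) within range g.
      norm (h u - h (g s) - D * (u - g s)) \<le> e' * norm (u - g s)"
    using deriv[unfolded has_field_derivative_def, THEN has_derivative_within_alt2[THEN iffD1],
        THEN conjunct2, rule_format, OF e'] .
  then obtain d where d: "0 < d" and exp_ne: "\<And>u. u \<in> range g \<Longrightarrow> u \<noteq> g s \<Longrightarrow> dist u (g s) < d \<Longrightarrow>
      \<bar>h u - h (g s) - D * (u - g s)\<bar> \<le> e' * \<bar>u - g s\<bar>"
    unfolding eventually_at by auto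
  have exp: "\<bar>h u - h (g s) - D * (u - g s)\<bar> \<le> e' * \<bar>u - g s\<bar>"
    if "u \<in> range g" "dist u (g s) < d" for u
    using exp_ne[OF that(1) _ that(2)] by (cases "u = g s") auto
  have "isCont g s"
    using convex_on_continuous[OF open_UNIV convex] by (simp add: continuous_on_eq_continuous_at)
  hence "\<forall>\<^sub>F t in nhds s. dist (g t) (g s) < d"
    using d by (simp add: isCont_def tendsto_iff eventually_nhds_conv_at)
  moreover have "\<forall>\<^sub>F t in nhds s. dist t s < 1"
    unfolding eventually_nhds_metric by (intro exI[of _ 1]) simp
  ultimately show ?thesis
  proof eventually_elim
    case (elim t)
    have "e' * \<bar>g t - g s\<bar> \<le> e' * (M * \<bar>t - s\<bar>)"
      using e' elim by (intro mult_left_mono lip) (auto simp: dist_real_def)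
    also have "\<dots> \<le> e * \<bar>t - s\<bar>" using e'_M by (simp add: mult_right_mono flip: mult.assoc)
    finally have "h (g s) + D * (g t - g s) - e * \<bar>t - s\<bar> \<le> h (g t)"
      using exp[of "g t"] elim by (simp add: abs_le_iff)
    moreover have "D * (\<nu> * (t - s)) \<le> D * (g t - g s)"
      using sub[of t] \<open>0 \<le> D\<close> by (intro mult_left_mono) auto
    ultimately show ?case by (simp add: mult.assoc)
  qed
qed

section \<open>Subgradients and the Kurdyka-Lojasiewicz inequality\<close>

lemma frechet_subdiffI:
  assumes "\<And>e. 0 < e \<Longrightarrow> \<forall>\<^sub>F y in at x. J x + v \<bullet> (y - x) - e * norm (y - x) \<le> J y"
  shows "v \<in> frechet_subdiff J x"
proof -
  have "\<forall>\<^sub>F y in at x. c < ereal ((J y - J x - v \<bullet> (y - x)) / norm (y - x))" if "c < 0" for c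
  proof -
    obtain e where e: "0 < e" "c < ereal (- e)"
    proof (cases c)
      case (real r)
      thus ?thesis using \<open>c < 0\<close> by (intro that[of "- r / 2"]) auto
    next
      case PInf
      thus ?thesis using \<open>c < 0\<close> by simp
    next
      case MInf
      thus ?thesis by (intro that[of 1]) auto
    qed
    have "\<forall>\<^sub>F y in at x. y \<noteq> x" by (simp add: eventually_at_filter)
    with assms[OF e(1)] show ?thesis
    proof eventually_elim
      case (elim y)
      hence "- e \<le> (J y - J x - v \<bullet> (y - x)) / norm (y - x)"
        by (simp add: field_simps)
      with e(2) show ?case by (meson ereal_less_eq(3) less_le_trans)
    qed
  qed
  thus ?thesis by (simp add: frechet_subdiff_def le_Liminf_iff)
qed

lemma frechet_subdiff_subset_limiting: "frechet_subdiff J x \<subseteq> limiting_subdiff J x"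
proof
  fix v assume "v \<in> frechet_subdiff J x"
  thus "v \<in> limiting_subdiff J x" unfolding limiting_subdiff_def
    by (intro CollectI exI[of _ "\<lambda>_. x"] exI[of _ "\<lambda>_. v"]) auto
qed

text \<open>
  The form in which the KL property enters the convergence proof. The tangent to the concave
  function \<open>\<phi>\<close> at \<open>J y - J z\<close> converts the lower bound on the subgradients at \<open>y\<close> into an upper bound
  on the decrease from \<open>J y\<close> to any \<open>s\<close> between \<open>J z\<close> and \<open>J y\<close>. This includes the case
  \<open>J y = J z\<close>, where both differences vanish. The bound \<open>\<xi>\<close> is replaced by a finite one.
\<close>

lemma KL_property_descent:
  assumes "KL_property J z"
  obtains r \<xi> :: real and \<phi> :: "real \<Rightarrow> real" where "0 < r" "0 < \<xi>"
    "\<And>t. 0 \<le> t \<Longrightarrow> t < \<xi> \<Longrightarrow> 0 \<le> \<phi> t"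
    "\<And>u. u \<longlonglongrightarrow> (0::real) \<Longrightarrow> (\<And>n. 0 \<le> u n) \<Longrightarrow> (\<lambda>n::nat. \<phi> (u n)) \<longlonglongrightarrow> 0"
    "\<And>y v s. dist y z < r \<Longrightarrow> v \<in> limiting_subdiff J y \<Longrightarrow> J z \<le> s \<Longrightarrow> s \<le> J y \<Longrightarrow> J y < J z + \<xi> \<Longrightarrow>
      \<phi> (s - J z) \<le> \<phi> (J y - J z) \<and> J y - s \<le> norm v * (\<phi> (J y - J z) - \<phi> (s - J z))"
proof -
  obtain U and \<xi>0 :: ereal and \<phi> \<phi>' :: "real \<Rightarrow> real" where U: "open U" "z \<in> U" and \<xi>0: "0 < \<xi>0"
    and nonneg: "\<And>t. 0 \<le> t \<and> ereal t < \<xi>0 \<Longrightarrow> 0 \<le> \<phi> t"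
    and concave: "concave_on {t. 0 \<le> t \<and> ereal t < \<xi>0} \<phi>"
    and cont: "continuous (at 0 within {t. 0 \<le> t \<and> ereal t < \<xi>0}) \<phi>" and zero: "\<phi> 0 = 0"
    and deriv: "\<And>t. 0 < t \<and> ereal t < \<xi>0 \<Longrightarrow> (\<phi> has_real_derivative \<phi>' t) (at t)"
    and pos: "\<And>t. 0 < t \<and> ereal t < \<xi>0 \<Longrightarrow> 0 < \<phi>' t"
    and KL: "\<And>y. y \<in> U \<Longrightarrow> J z < J y \<and> ereal (J y) < ereal (J z) + \<xi>0 \<Longrightarrow>
        1 \<le> ereal (\<phi>' (J y - J z)) * (INF v\<in>limiting_subdiff J y. ereal (dist 0 v))"
    using assms unfolding KL_property_def by blast
  obtain r where r: "0 < r" "ball z r \<subseteq> U" using U open_contains_ball by blast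
  \<comment> \<open>any positive real below the extended bound will do, the inequality being local\<close>
  obtain \<xi> :: real where \<xi>: "0 < \<xi>" "ereal \<xi> < \<xi>0"
    using ereal_dense2[OF \<xi>0] by (auto simp: zero_ereal_def)
  let ?I = "{t. 0 \<le> t \<and> ereal t < \<xi>0}"
  have I: "t \<in> ?I" if "0 \<le> t" "t < \<xi>" for t
    using that \<xi> by (auto intro: less_trans[of "ereal t" "ereal \<xi>"])
  show thesis
  proof (rule that[OF r(1) \<xi>(1)])
    show "0 \<le> \<phi> t" if "0 \<le> t" "t < \<xi>" for t using nonneg I[OF that] by simp
    show "(\<lambda>n::nat. \<phi> (u n)) \<longlonglongrightarrow> 0" if u: "u \<longlonglongrightarrow> (0::real)" "\<And>n. 0 \<le> u n" for u
    proof -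
      have "\<forall>\<^sub>F n in sequentially. u n \<in> ?I"
        using order_tendstoD(2)[OF u(1) \<xi>(1)] by eventually_elim (intro I u(2))
      from continuous_within_tendsto_compose[OF cont this u(1)] show ?thesis by (simp add: zero)
    qed
    show "\<phi> (s - J z) \<le> \<phi> (J y - J z) \<and> J y - s \<le> norm v * (\<phi> (J y - J z) - \<phi> (s - J z))"
      if near: "dist y z < r" and v: "v \<in> limiting_subdiff J y"
        and s: "J z \<le> s" "s \<le> J y" and small: "J y < J z + \<xi>" for y v s
    proof (cases "J y = J z")
      case True
      thus ?thesis using s by simp
    next
      case False
      let ?t = "J y - J z"
      have t: "0 < ?t" "?t < \<xi>" using False s small by auto
      have tI: "?t \<in> ?I" "s - J z \<in> ?I" using s t by (intro I; linarith)+
      have p: "0 < \<phi>' ?t" using t tI by (intro pos) simp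
      have "\<phi> (s - J z) \<le> \<phi> ?t + \<phi>' ?t * ((s - J z) - ?t)"
        using t tI(1) by (intro concave_on_imp_below_tangent_within[OF concave tI]
            DERIV_subset[OF deriv subset_UNIV]) simp
      hence tangent: "\<phi>' ?t * (J y - s) \<le> \<phi> ?t - \<phi> (s - J z)" by (simp add: algebra_simps)
      have "y \<in> U" using near r by (auto simp: dist_commute)
      moreover have "ereal (J y) < ereal (J z) + \<xi>0"
      proof (cases \<xi>0)
        case (real c)
        thus ?thesis using small \<xi> by simp
      qed (use \<xi>0 in auto)
      ultimately have "1 \<le> ereal (\<phi>' ?t) * (INF v\<in>limiting_subdiff J y. ereal (dist 0 v))"
        using t by (intro KL) auto
      also have "\<dots> \<le> ereal (\<phi>' ?t) * ereal (dist 0 v)"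
        using p v by (intro ereal_mult_left_mono INF_lower) auto
      finally have "1 \<le> \<phi>' ?t * norm v" by (simp add: one_ereal_def)
      hence "1 * (J y - s) \<le> (\<phi>' ?t * norm v) * (J y - s)" using s by (intro mult_right_mono) auto
      also have "\<dots> = norm v * (\<phi>' ?t * (J y - s))" by simp
      also have "\<dots> \<le> norm v * (\<phi> ?t - \<phi> (s - J z))" using tangent by (rule mult_left_mono) simp
      finally have "J y - s \<le> norm v * (\<phi> ?t - \<phi> (s - J z))" by simp
      moreover have "0 \<le> \<phi>' ?t * (J y - s)" using p s by (intro mult_nonneg_nonneg) auto
      ultimately show ?thesis using tangent by linarith
    qed
  qed
qed

section \<open>Blocks of coordinates\<close>

lemma blk_nth [simp]: "blk S u $ j = (if j \<in> S then u $ j else 0)"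
  by (simp add: blk_def)

lemma repl_nth [simp]: "repl S u v $ j = (if j \<in> S then v $ j else u $ j)"
  by (simp add: repl_def)

lemma in_range_blk_iff: "u \<in> range (blk S) \<longleftrightarrow> (\<forall>j. j \<notin> S \<longrightarrow> u $ j = 0)"
proof
  assume "\<forall>j. j \<notin> S \<longrightarrow> u $ j = 0"
  hence "u = blk S u" by (simp add: vec_eq_iff)
  thus "u \<in> range (blk S)" by blast
qed auto

lemma blk_diff: "blk S (u - v) = blk S u - blk S (v :: real ^ 'n::finite)"
  by (simp add: vec_eq_iff)

lemma inner_eq_inner_blk:
  fixes u d :: "real ^ 'n::finite"
  assumes "d \<in> range (blk S)"
  shows "u \<bullet> d = blk S u \<bullet> d"
  using assms unfolding inner_vec_def by (intro sum.cong) (auto simp: in_range_blk_iff)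

lemma block_lipschitzD:
  fixes df :: "real ^ 'n::finite \<Rightarrow> real ^ 'n"
  assumes "block_lipschitz df S x c" and d: "d \<in> range (blk S)"
  shows "norm (blk S (df (x + d)) - blk S (df x)) \<le> c * norm d"
proof -
  have eq: "repl S x (blk S x + d) = x + d" "repl S x (blk S x) = x"
    using d by (auto simp: vec_eq_iff in_range_blk_iff)
  have "blk S x + d \<in> range (blk S)" "blk S x \<in> range (blk S)"
    using d by (auto simp: in_range_blk_iff)
  from lipschitz_on_normD[OF assms(1)[unfolded block_lipschitz_def] this] show ?thesis
    by (simp add: eq)
qed

text \<open>
  The descent lemma along a direction supported in one block. The Lipschitz bound along the segment
  makes the derivative of \<open>\<psi>\<close> nonpositive.
\<close>

lemma block_descent:
  fixes f :: "real ^ 'n::finite \<Rightarrow> real"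
  assumes grad: "\<And>y. GDERIV f y :> df y" and lip: "block_lipschitz df S x c"
    and d: "d \<in> range (blk S)"
  shows "f (x + d) \<le> f x + df x \<bullet> d + c / 2 * (norm d)\<^sup>2"
proof -
  define \<psi> where "\<psi> t = f (x + t *\<^sub>R d) - t * (df x \<bullet> d) - c / 2 * t\<^sup>2 * (norm d)\<^sup>2" for t
  have "\<psi> 1 \<le> \<psi> 0"
  proof (rule DERIV_nonpos_imp_nonincreasing[of 0 1 \<psi>])
    fix t :: real assume t: "0 \<le> t" "t \<le> 1"
    let ?D = "df (x + t *\<^sub>R d) \<bullet> d - df x \<bullet> d - c * t * (norm d)\<^sup>2"
    have line: "((\<lambda>t. f (x + t *\<^sub>R d)) has_real_derivative df (x + t *\<^sub>R d) \<bullet> d) (at t)"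
    proof -
      have "(f has_derivative (\<lambda>h. h \<bullet> df (x + t *\<^sub>R d))) (at (x + t *\<^sub>R d))"
        using grad by (simp add: gderiv_def)
      moreover have "((\<lambda>t. x + t *\<^sub>R d) has_derivative (\<lambda>h. h *\<^sub>R d)) (at t)"
        by (auto intro!: derivative_eq_intros)
      ultimately have "((\<lambda>t. f (x + t *\<^sub>R d)) has_derivative
          (\<lambda>h. (h *\<^sub>R d) \<bullet> df (x + t *\<^sub>R d))) (at t)"
        by (rule has_derivative_compose[rotated])
      thus ?thesis
        by (simp add: has_field_derivative_def inner_commute mult_commute_abs)
    qed
    have D: "(\<psi> has_real_derivative ?D) (at t)"
      unfolding \<psi>_def by (auto intro!: derivative_eq_intros line)
    have "?D \<le> 0"
    proof -
      have td: "t *\<^sub>R d \<in> range (blk S)" using d by (auto simp: in_range_blk_iff)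
      have "(df (x + t *\<^sub>R d) - df x) \<bullet> d = (blk S (df (x + t *\<^sub>R d)) - blk S (df x)) \<bullet> d"
        using inner_eq_inner_blk[OF d, of "df (x + t *\<^sub>R d) - df x"] by (simp only: blk_diff)
      also have "\<dots> \<le> norm (blk S (df (x + t *\<^sub>R d)) - blk S (df x)) * norm d"
        by (rule norm_cauchy_schwarz)
      also have "\<dots> \<le> (c * norm (t *\<^sub>R d)) * norm d"
        using block_lipschitzD[OF lip td] by (rule mult_right_mono) simp
      finally show ?thesis using t by (simp add: inner_diff_left power2_eq_square algebra_simps)
    qed
    with D show "\<exists>D. DERIV \<psi> t :> D \<and> D \<le> 0" by blast
  qed simp
  thus ?thesis by (simp add: \<psi>_def)
qed

text \<open>
  The first-order condition of the proximal step as a variational inequality in which the convex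
  part appears through its values, so that subgradients of \<open>g\<close> are not needed. It follows by
  comparing the minimizer with \<open>u + t d\<close>, dividing by \<open>t\<close> and letting \<open>t\<close> tend to \<open>0\<close>. The choice
  \<open>d = - (x i - x (i - 1))\<close> yields the decrease of the objective, and \<open>d\<close> parallel to a coordinate
  axis yields subgradients of \<open>g\<close>.
\<close>

lemma proximal_step_optimality:
  fixes G c u d :: "real ^ 'n::finite"
  assumes min: "is_arg_min (\<lambda>y. G \<bullet> y + a * (norm (y - c))\<^sup>2 + (\<Sum>j\<in>S. w j * g (y $ j)))
      (\<lambda>y. y \<in> range (blk S)) u"
    and convex: "convex_on UNIV g" and w: "\<And>j. 0 \<le> w j" and a: "0 \<le> a"
    and d: "d \<in> range (blk S)"
  shows "0 \<le> (G + (2 * a) *\<^sub>R (u - c)) \<bullet> d + (\<Sum>j\<in>S. w j * (g (u $ j + d $ j) - g (u $ j)))"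
    (is "0 \<le> ?A")
proof -
  let ?B = "a * (norm d)\<^sup>2"
  have u: "u \<in> range (blk S)" using min by (simp add: is_arg_min_def)
  have slope: "0 \<le> ?A + t * ?B" if t: "0 < t" "t \<le> 1" for t
  proof -
    have "u + t *\<^sub>R d \<in> range (blk S)" using u d by (auto simp: in_range_blk_iff)
    hence "G \<bullet> u + a * (norm (u - c))\<^sup>2 + (\<Sum>j\<in>S. w j * g (u $ j))
        \<le> G \<bullet> (u + t *\<^sub>R d) + a * (norm (u + t *\<^sub>R d - c))\<^sup>2
          + (\<Sum>j\<in>S. w j * g ((u + t *\<^sub>R d) $ j))"
      using min unfolding is_arg_min_linorder by blast
    moreover have "(norm (u + t *\<^sub>R d - c))\<^sup>2
        = (norm (u - c))\<^sup>2 + 2 * t * ((u - c) \<bullet> d) + t\<^sup>2 * (norm d)\<^sup>2"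
      unfolding power2_norm_eq_inner
      by (simp add: inner_simps inner_commute algebra_simps power2_eq_square)
    moreover have "(\<Sum>j\<in>S. w j * g ((u + t *\<^sub>R d) $ j))
        \<le> (\<Sum>j\<in>S. w j * g (u $ j)) + t * (\<Sum>j\<in>S. w j * (g (u $ j + d $ j) - g (u $ j)))"
    proof -
      have "w j * g ((u + t *\<^sub>R d) $ j)
          \<le> w j * g (u $ j) + t * (w j * (g (u $ j + d $ j) - g (u $ j)))" for j
      proof -
        have "g ((1 - t) *\<^sub>R u $ j + t *\<^sub>R (u $ j + d $ j))
            \<le> (1 - t) * g (u $ j) + t * g (u $ j + d $ j)"
          using convex t by (intro convex_onD) auto
        also have "(1 - t) *\<^sub>R u $ j + t *\<^sub>R (u $ j + d $ j) = (u + t *\<^sub>R d) $ j"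
          by (simp add: algebra_simps)
        finally have "g ((u + t *\<^sub>R d) $ j) \<le> g (u $ j) + t * (g (u $ j + d $ j) - g (u $ j))"
          by (simp add: algebra_simps)
        from mult_left_mono[OF this w[of j]] show ?thesis by (simp add: algebra_simps)
      qed
      thus ?thesis unfolding sum_distrib_left sum.distrib[symmetric] by (intro sum_mono)
    qed
    ultimately have "0 \<le> t * (G \<bullet> d) + a * (2 * t * ((u - c) \<bullet> d) + t\<^sup>2 * (norm d)\<^sup>2)
        + t * (\<Sum>j\<in>S. w j * (g (u $ j + d $ j) - g (u $ j)))"
      by (simp add: inner_add_right distrib_left)
    also have "\<dots> = t * (?A + t * ?B)"
      by (simp add: inner_add_left power2_eq_square algebra_simps)
    finally show ?thesis using t by (simp add: zero_le_mult_iff)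
  qed
  have "((\<lambda>t. ?A + t * ?B) \<longlongrightarrow> ?A + 0 * ?B) (at_right 0)"
    by (intro tendsto_intros)
  moreover have "\<forall>\<^sub>F t in at_right 0. 0 \<le> ?A + t * ?B"
    unfolding eventually_at_right_field using slope by (intro exI[of _ 1]) auto
  ultimately show ?thesis
    using tendsto_lowerbound[of "\<lambda>t. ?A + t * ?B" "?A + 0 * ?B" "at_right 0" 0] by simp
qed

lemma update_time_update_count:
  assumes "b i = S" "1 \<le> i"
  shows "update_time b S (update_count b S i) = i"
  unfolding update_time_def
proof (rule Least_equality)
  fix k assume eq: "update_count b S k = update_count b S i"
  show "i \<le> k"
  proof (rule ccontr)
    assume "\<not> i \<le> k"
    hence "{j \<in> {1..k}. b j = S} \<subset> {j \<in> {1..i}. b j = S}" using assms by force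
    hence "update_count b S k < update_count b S i"
      unfolding update_count_def by (intro psubset_card_mono) auto
    with eq show False by simp
  qed
qed simp

section \<open>The objective function\<close>

lemma objective_eq_sum_coordinates:
  assumes "partition_on UNIV P"
  shows "objective P f g h lam x = f x + lam * (\<Sum>j\<in>UNIV. h (g (x $ j)))"
proof -
  have "(\<Sum>j\<in>UNIV. h (g (x $ j))) = (\<Sum>S\<in>P. \<Sum>j\<in>S. h (g (x $ j)))"
    using assms sum.Union_disjoint[of P "\<lambda>j. h (g (x $ j))"]
    by (auto simp: partition_on_def disjoint_def)
  thus ?thesis by (simp add: objective_def)
qed

lemma continuous_on_objective:
  fixes f :: "real ^ 'n::finite \<Rightarrow> real"
  assumes part: "partition_on UNIV P"
    and grad: "\<And>y. GDERIV f y :> df y"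
    and convex: "convex_on UNIV g"
    and deriv: "\<And>t. (h has_real_derivative dh (g t)) (at (g t) within range g)"
  shows "continuous_on UNIV (objective P f g h lam)"
proof -
  have f: "continuous_on UNIV f"
    using grad unfolding gderiv_def
    by (intro continuous_at_imp_continuous_on ballI has_derivative_continuous) auto
  have g: "continuous_on UNIV g" by (rule convex_on_continuous[OF open_UNIV convex])
  have "continuous_on (range g) h"
    using deriv by (auto intro!: DERIV_continuous_on[where D = dh])
  hence hg: "continuous_on UNIV (\<lambda>t. h (g t))"
    by (rule continuous_on_compose2[OF _ g]) simp
  have "continuous_on UNIV (\<lambda>x::real ^ 'n. h (g (x $ j)))" for j
    by (rule continuous_on_compose2[OF hg]) (auto intro!: continuous_intros)
  hence "continuous_on UNIV (\<lambda>x. f x + lam * (\<Sum>j\<in>UNIV. h (g (x $ j))))"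
    by (intro continuous_intros f)
  thus ?thesis by (simp add: objective_eq_sum_coordinates[OF part])
qed

text \<open>
  The objective is a sum of a differentiable function and of functions of single coordinates, so
  subgradients can be put together coordinatewise. The error allowed to each coordinate is chosen
  such that the total is at most \<open>e / 2\<close>.
\<close>

lemma objective_subgradient:
  fixes f :: "real ^ 'n::finite \<Rightarrow> real"
  assumes part: "partition_on UNIV P"
    and grad: "GDERIV f x :> df x"
    and convex: "convex_on UNIV g" and nonneg: "\<And>t. 0 \<le> g t"
    and deriv: "\<And>t. (h has_real_derivative dh (g t)) (at (g t) within range g)"
    and dh: "\<And>t. 0 \<le> dh (g t)" and lam: "0 < lam"
    and sub: "\<And>j t. g (x $ j) + \<nu> j * (t - x $ j) \<le> g t"
  shows "(\<chi> j. df x $ j + lam * dh (g (x $ j)) * \<nu> j) \<in> frechet_subdiff (objective P f g h lam) x"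
proof (rule frechet_subdiffI)
  fix e :: real assume "0 < e"
  define c where "c = e / 2 / (lam * CARD('n))"
  have c: "0 < c" using \<open>0 < e\<close> lam by (simp add: c_def)
  have c_eq: "lam * (CARD('n) * c) = e / 2" using lam by (simp add: c_def)
  have "\<forall>\<^sub>F y in at x. norm (f y - f x - (y - x) \<bullet> df x) \<le> (e / 2) * norm (y - x)"
    using grad[unfolded gderiv_def, THEN has_derivative_within_alt2[THEN iffD1],
        THEN conjunct2, rule_format, of "e / 2"] \<open>0 < e\<close> by simp
  moreover have "\<forall>\<^sub>F y in at x. \<forall>j. h (g (x $ j)) + dh (g (x $ j)) * \<nu> j * (y $ j - x $ j)
      - c * \<bar>y $ j - x $ j\<bar> \<le> h (g (y $ j))"
  proof (rule eventually_all_finite)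
    fix j :: 'n
    have "filterlim (\<lambda>y. y $ j) (nhds (x $ j)) (at x)"
      by (intro tendsto_vec_nth tendsto_ident_at)
    from eventually_compose_filterlim[OF
        scalar_composite_lower_expansion[OF convex nonneg sub deriv dh c] this]
    show "\<forall>\<^sub>F y in at x. h (g (x $ j)) + dh (g (x $ j)) * \<nu> j * (y $ j - x $ j)
      - c * \<bar>y $ j - x $ j\<bar> \<le> h (g (y $ j))" .
  qed
  ultimately show "\<forall>\<^sub>F y in at x. objective P f g h lam x +
      (\<chi> j. df x $ j + lam * dh (g (x $ j)) * \<nu> j) \<bullet> (y - x) - e * norm (y - x)
      \<le> objective P f g h lam y"
  proof eventually_elim
    case (elim y)
    have "(\<Sum>j\<in>UNIV. h (g (x $ j)) + dh (g (x $ j)) * \<nu> j * (y $ j - x $ j) - c * norm (y - x))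
        \<le> (\<Sum>j\<in>UNIV. h (g (y $ j)))"
    proof (rule sum_mono)
      fix j
      have "c * \<bar>y $ j - x $ j\<bar> \<le> c * norm (y - x)"
        using c component_le_norm_cart[of "y - x" j] by (intro mult_left_mono) auto
      thus "h (g (x $ j)) + dh (g (x $ j)) * \<nu> j * (y $ j - x $ j) - c * norm (y - x)
          \<le> h (g (y $ j))"
        using elim(2)[rule_format, of j] by simp
    qed
    hence "lam * ((\<Sum>j\<in>UNIV. h (g (x $ j))) + (\<Sum>j\<in>UNIV. dh (g (x $ j)) * \<nu> j * (y $ j - x $ j))
          - CARD('n) * c * norm (y - x)) \<le> lam * (\<Sum>j\<in>UNIV. h (g (y $ j)))"
      using lam by (intro mult_left_mono) (simp_all add: sum.distrib sum_subtractf)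
    moreover have "lam * (CARD('n) * c * norm (y - x)) = e / 2 * norm (y - x)"
      using c_eq by (simp add: mult.assoc[symmetric])
    ultimately have reg: "lam * (\<Sum>j\<in>UNIV. h (g (x $ j)))
        + lam * (\<Sum>j\<in>UNIV. dh (g (x $ j)) * \<nu> j * (y $ j - x $ j)) - e / 2 * norm (y - x)
        \<le> lam * (\<Sum>j\<in>UNIV. h (g (y $ j)))"
      unfolding right_diff_distrib distrib_left by linarith
    have smooth: "f x + (y - x) \<bullet> df x - e / 2 * norm (y - x) \<le> f y"
      using elim(1) unfolding real_norm_def by linarith
    have "(\<chi> j. df x $ j + lam * dh (g (x $ j)) * \<nu> j) \<bullet> (y - x) =
        (y - x) \<bullet> df x + lam * (\<Sum>j\<in>UNIV. dh (g (x $ j)) * \<nu> j * (y $ j - x $ j))"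
      by (simp add: inner_vec_def sum.distrib[symmetric] sum_distrib_left algebra_simps)
    thus ?case
      using reg smooth by (simp add: objective_eq_sum_coordinates[OF part])
  qed
qed

section \<open>Sufficient decrease along the iterates\<close>

text \<open>
  A run of the algorithm for a fixed length \<open>T\<close> of the intervals in which every block is updated.
\<close>

locale bpiree_iterates =
  fixes P :: "'n::finite set set"
    and f :: "real ^ 'n \<Rightarrow> real" and df :: "real ^ 'n \<Rightarrow> real ^ 'n"
    and g h dh :: "real \<Rightarrow> real"
    and lam l L Lh \<delta> :: real
    and L0 :: "'n set \<Rightarrow> real"
    and Lk \<alpha> \<beta> :: "nat \<Rightarrow> real"
    and b :: "nat \<Rightarrow> 'n set"
    and x :: "nat \<Rightarrow> real ^ 'n"
    and T :: nat
  assumes part: "partition_on UNIV P"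
    and lam_pos: "0 < lam"
    and smooth: "smooth_assms P f df l L"
    and inner: "inner_assms g"
    and outer: "outer_assms g h dh Lh"
    and run: "bpiree P df g dh lam \<alpha> \<beta> b x"
    and params: "parameter_rule P df l L \<delta> L0 Lk \<alpha> \<beta> b x"
    and cyclic: "\<And>S k. S \<in> P \<Longrightarrow> 1 \<le> k \<Longrightarrow> \<exists>i\<in>{k..<k + T}. b i = S"
    and decreasing: "\<And>k. 1 \<le> k \<Longrightarrow> objective P f g h lam (x k) \<le> objective P f g h lam (x (k - 1))"
begin

abbreviation F where "F \<equiv> objective P f g h lam"

lemma grad: "GDERIV f y :> df y"
  and l_pos: "0 < l" and l_le_L: "l \<le> L"
  using smooth by (auto simp: smooth_assms_def)

lemma g_nonneg: "0 \<le> g t" and g_convex: "convex_on UNIV g"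
  using inner by (auto simp: inner_assms_def)

lemma h_concave: "concave_on (range g) h"
  and h_deriv: "(h has_real_derivative dh (g t)) (at (g t) within range g)"
  and dh_pos: "0 < dh (g t)"
  and dh_lipschitz: "\<bar>dh (g s) - dh (g t)\<bar> \<le> Lh * \<bar>g s - g t\<bar>"
  using outer by (auto simp: outer_assms_def)

lemma b_in_P: "1 \<le> k \<Longrightarrow> b k \<in> P"
  and beta_nonneg: "1 \<le> k \<Longrightarrow> 0 \<le> \<beta> k" and beta_le_1: "1 \<le> k \<Longrightarrow> \<beta> k \<le> 1"
  using run by (auto simp: bpiree_def Let_def)

lemma Lk_ge: "1 \<le> k \<Longrightarrow> l \<le> Lk k" and Lk_le: "1 \<le> k \<Longrightarrow> Lk k \<le> L"
  and Lk_lipschitz: "1 \<le> k \<Longrightarrow> block_lipschitz df (b k) (x (k - 1)) (Lk k)"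
  and alpha_eq: "1 \<le> k \<Longrightarrow> \<alpha> k = 1 / (2 * Lk k)"
  using params by (auto simp: parameter_rule_def)

lemma Lk_pos: "1 \<le> k \<Longrightarrow> 0 < Lk k"
  using Lk_ge[of k] l_pos by simp

lemma delta_le: "0 \<le> \<delta>" "\<delta> \<le> 1"
  using params by (auto simp: parameter_rule_def)

lemma coordinate_block: obtains S where "S \<in> P" "j \<in> S"
proof -
  have "j \<in> \<Union> P" using part by (simp add: partition_on_def)
  thus thesis using that by blast
qed

lemma same_block: "S \<in> P \<Longrightarrow> S' \<in> P \<Longrightarrow> j \<in> S \<Longrightarrow> j \<in> S' \<Longrightarrow> S = S'"
  using part by (auto simp: partition_on_def disjoint_def)

lemma T_pos: "0 < T"
proof -
  obtain S where "S \<in> P" using coordinate_block by blast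
  thus ?thesis using cyclic[of S 1] by auto
qed

definition inc :: "nat \<Rightarrow> real ^ 'n" where "inc i = x i - x (i - 1)"

text \<open>
  The most recent update of \<open>S\<close> strictly before time \<open>k\<close>. After the first \<open>T\<close> iterations every block
  has been updated, so that the maximum is taken over a nonempty set.
\<close>

definition latest :: "'n set \<Rightarrow> nat \<Rightarrow> nat" where "latest S k = Max {i \<in> {1..<k}. b i = S}"

definition prior :: "nat \<Rightarrow> nat" where "prior i = latest (b i) i"

text \<open>
  The point of the full space at which the gradient is evaluated in iteration \<open>i\<close>: block \<open>b i\<close> is
  extrapolated along its previous step, the other blocks are those of \<open>x (i - 1)\<close>.
\<close>

definition trial :: "nat \<Rightarrow> real ^ 'n" where "trial i = x (i - 1) + \<beta> i *\<^sub>R inc (prior i)"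

text \<open>
  Its coordinates in block \<open>b i\<close> form the gradient of the smooth part of the model minimized in
  iteration \<open>i\<close>, taken at the minimizer. The factor is \<open>1 / \<alpha> i = 2 * Lk i\<close>.
\<close>

definition residual :: "nat \<Rightarrow> real ^ 'n"
  where "residual i = df (trial i) + (2 * Lk i) *\<^sub>R (inc i - \<beta> i *\<^sub>R inc (prior i))"

lemma latest:
  assumes "S \<in> P" "T < k"
  shows latest_bounds: "1 \<le> latest S k" "k - T \<le> latest S k" "latest S k < k"
    and b_latest: "b (latest S k) = S"
    and latest_max: "\<And>i. latest S k < i \<Longrightarrow> i < k \<Longrightarrow> b i \<noteq> S"
proof -
  let ?K = "{i \<in> {1..<k}. b i = S}"
  obtain i where i: "k - T \<le> i" "i < k" "b i = S"
    using cyclic[OF assms(1), of "k - T"] assms(2) by fastforce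
  have fin: "finite ?K" by simp
  have iK: "i \<in> ?K" using i assms(2) by auto
  hence mem: "latest S k \<in> ?K" unfolding latest_def using Max_in[OF fin] by blast
  have ge: "i \<le> latest S k" unfolding latest_def using Max_ge[OF fin iK] .
  show "1 \<le> latest S k" "k - T \<le> latest S k" "latest S k < k" "b (latest S k) = S"
    using mem ge i by auto
  show "b i \<noteq> S" if "latest S k < i" "i < k" for i
  proof
    assume "b i = S"
    hence "i \<in> ?K" using that by auto
    from Max_ge[OF fin this] that show False by (simp add: latest_def)
  qed
qed

lemma prior:
  assumes "T < i"
  shows prior_bounds: "1 \<le> prior i" "i - T \<le> prior i" "prior i < i"
    and b_prior: "b (prior i) = b i"
    and prior_max: "\<And>k. prior i < k \<Longrightarrow> k < i \<Longrightarrow> b k \<noteq> b i"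
  using latest[of "b i" i] b_in_P[of i] assms by (auto simp: prior_def)

text \<open>
  An update has at most one successor in the same block. This keeps the errors of different
  iterations from accumulating on the same earlier step.
\<close>

lemma inj_on_prior: "inj_on prior {i. T < i}"
proof (rule inj_onI)
  have "False" if "T < i" "i < k" "prior i = prior k" for i k
    using that prior_max[of k i] b_prior[of i] b_prior[of k] prior_bounds(3)[of i] by auto
  thus "i = k" if "i \<in> {i. T < i}" "k \<in> {i. T < i}" "prior i = prior k" for i k
    using that by (metis linorder_neqE_nat mem_Collect_eq)
qed

lemma inc_in_block: "1 \<le> i \<Longrightarrow> inc i \<in> range (blk (b i))"
proof -
  assume i: "1 \<le> i"
  have "inc i $ j = 0" if "j \<notin> b i" for j
  proof -
    obtain S where S: "S \<in> P" "j \<in> S" by (rule coordinate_block)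
    have "blk S (x i) = blk S (x (i - 1))"
      using run i S that by (auto simp: bpiree_def Let_def)
    hence "blk S (x i) $ j = blk S (x (i - 1)) $ j" by simp
    thus ?thesis using S by (simp add: inc_def)
  qed
  thus ?thesis by (simp add: in_range_blk_iff)
qed

lemma block_constant:
  assumes "m \<le> k" "\<And>i. m < i \<Longrightarrow> i \<le> k \<Longrightarrow> b i \<noteq> S" and S: "S \<in> P" "j \<in> S"
  shows "x k $ j = x m $ j"
  using assms(1,2)
proof (induction k rule: dec_induct)
  case (step k)
  have "b (Suc k) \<noteq> S" using step by simp
  hence "j \<notin> b (Suc k)"
    using same_block[OF _ S(1) _ S(2)] b_in_P[of "Suc k"] by auto
  hence "inc (Suc k) $ j = 0"
    using inc_in_block[of "Suc k"] by (auto simp: in_range_blk_iff)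
  with step show ?case by (simp add: inc_def)
qed simp

lemma extrapolated_eq:
  assumes "T < i"
  shows "extrapolated \<beta> b x (b i) i = blk (b i) (trial i)"
    and "repl (b i) (x (i - 1)) (blk (b i) (trial i)) = trial i"
proof -
  have i: "1 \<le> i" using assms by simp
  let ?K = "{k \<in> {1..<i}. b k = b i}"
  have "prior i \<in> ?K" using prior_bounds[OF assms] b_prior[OF assms] by auto
  hence prev: "prev_iterate b x (b i) i = x (prior i - 1)"
    unfolding prev_iterate_def prior_def latest_def Let_def by auto
  have const: "x (i - 1) $ j = x (prior i) $ j" if "j \<in> b i" for j
    using prior_bounds[OF assms] prior_max[OF assms] b_in_P[OF i] that
    by (intro block_constant[where S = "b i"]) auto
  show ext: "extrapolated \<beta> b x (b i) i = blk (b i) (trial i)"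
    using const by (auto simp: vec_eq_iff extrapolated_def prev trial_def inc_def)
  have "inc (prior i) $ j = 0" if "j \<notin> b i" for j
    using inc_in_block[OF prior_bounds(1)[OF assms]] that
    by (simp add: b_prior[OF assms] in_range_blk_iff)
  thus "repl (b i) (x (i - 1)) (blk (b i) (trial i)) = trial i"
    by (auto simp: vec_eq_iff trial_def)
qed

lemma optimality:
  assumes "T < i" and d: "d \<in> range (blk (b i))"
  shows "0 \<le> residual i \<bullet> d
    + lam * (\<Sum>j\<in>b i. dh (g (x (i - 1) $ j)) * (g (x i $ j + d $ j) - g (x i $ j)))"
proof -
  have i: "1 \<le> i" using assms by simp
  have a: "1 / (2 * \<alpha> i) = Lk i" using Lk_pos[OF i] by (simp add: alpha_eq[OF i])
  have "is_arg_min (\<lambda>y. blk (b i) (df (trial i)) \<bullet> y + Lk i * (norm (y - blk (b i) (trial i)))\<^sup>2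
      + (\<Sum>j\<in>b i. lam * dh (g (x (i - 1) $ j)) * g (y $ j)))
      (\<lambda>y. y \<in> range (blk (b i))) (blk (b i) (x i))"
    using run[unfolded bpiree_def Let_def, THEN spec, THEN mp, OF i]
    unfolding extrapolated_eq[OF assms(1)] a by blast
  from proximal_step_optimality[OF this g_convex _ _ d]
  have "0 \<le> (blk (b i) (df (trial i)) + (2 * Lk i) *\<^sub>R (blk (b i) (x i) - blk (b i) (trial i))) \<bullet> d
      + (\<Sum>j\<in>b i. lam * dh (g (x (i - 1) $ j)) * (g (blk (b i) (x i) $ j + d $ j) - g (blk (b i) (x i) $ j)))"
    using lam_pos dh_pos Lk_pos[OF i] by (simp add: less_imp_le)
  also have "(blk (b i) (df (trial i)) + (2 * Lk i) *\<^sub>R (blk (b i) (x i) - blk (b i) (trial i))) \<bullet> d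
      = residual i \<bullet> d"
  proof -
    have "blk (b i) (df (trial i)) + (2 * Lk i) *\<^sub>R (blk (b i) (x i) - blk (b i) (trial i))
        = blk (b i) (residual i)"
      by (auto simp: vec_eq_iff residual_def trial_def inc_def)
    thus ?thesis using inner_eq_inner_blk[OF d] by simp
  qed
  finally show ?thesis by (simp add: sum_distrib_left mult.assoc cong: sum.cong)
qed

text \<open>
  The parameter rule, which counts the updates of each block separately, rewritten in terms of
  iteration numbers.
\<close>

lemma beta_bound:
  assumes "T < i"
  shows "\<beta> i \<le> 1/6 * sqrt (Lk (prior i) / Lk i)"
proof -
  let ?S = "b i"
  have i: "1 \<le> i" using assms by simp
  have p: "1 \<le> prior i" "prior i < i" "b (prior i) = ?S"
    using prior_bounds[OF assms] b_prior[OF assms] by auto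
  have "{k \<in> {1..i}. b k = ?S} = insert i {k \<in> {1..prior i}. b k = ?S}"
    using i p prior_max[OF assms] by (auto simp: not_less le_less) (metis linorder_neqE_nat)+
  hence count: "update_count b ?S i = Suc (update_count b ?S (prior i))"
    using p by (simp add: update_count_def)
  have "prior i \<in> {k \<in> {1..prior i}. b k = ?S}" using p by auto
  hence "update_count b ?S (prior i) \<noteq> 0" unfolding update_count_def by auto
  hence tilde: "tilde_L L0 Lk b ?S (update_count b ?S i) = Lk i"
    "tilde_L L0 Lk b ?S (update_count b ?S i - 1) = Lk (prior i)"
    "tilde_beta \<beta> b ?S (update_count b ?S i) = \<beta> i"
    unfolding tilde_L_def tilde_beta_def
    using update_time_update_count[of b i ?S] update_time_update_count[of b "prior i" ?S] i p count
    by auto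
  have "tilde_beta \<beta> b ?S j \<le> \<delta> / 6 * sqrt (tilde_L L0 Lk b ?S (j - 1) / tilde_L L0 Lk b ?S j)"
    if "1 \<le> j" for j
    using params b_in_P[OF i] that by (simp add: parameter_rule_def)
  from this[of "update_count b ?S i"] have "\<beta> i \<le> \<delta> / 6 * sqrt (Lk (prior i) / Lk i)"
    unfolding tilde using count by simp
  also have "\<dots> \<le> 1 / 6 * sqrt (Lk (prior i) / Lk i)"
    using delta_le Lk_pos[OF i] Lk_pos[OF p(1)] by (intro mult_right_mono) auto
  finally show ?thesis .
qed

definition energy :: "nat \<Rightarrow> real" where "energy i = Lk i * (norm (inc i))\<^sup>2"

lemma energy_nonneg: "1 \<le> i \<Longrightarrow> 0 \<le> energy i"
  using Lk_pos[of i] by (simp add: energy_def)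

text \<open>
  The optimality inequality in the direction back to \<open>x (i - 1)\<close> controls both the regularizer,
  through the tangent of \<open>h\<close>, and the linear term of \<open>f\<close>. Descent lemma and proximal term leave
  \<open>- 3/2 * energy i\<close>. The extrapolation contributes a mixed term \<open>3 * Lk i * \<beta> i\<close> times the product
  of the two step lengths: one part from the gradient at the trial point, two from the proximal
  centre. The bound on \<open>\<beta> i\<close> is made for splitting this term evenly between the two energies.
\<close>

lemma step_decrease:
  assumes "T < i"
  shows "F (x i) \<le> F (x (i - 1)) - 5/4 * energy i + 1/4 * energy (prior i)"
proof -
  have i: "1 \<le> i" using assms by simp
  have p: "1 \<le> prior i" using prior_bounds[OF assms] by simp
  let ?d = "inc i" and ?e = "\<beta> i *\<^sub>R inc (prior i)" and ?S = "b i"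
  have d: "?d \<in> range (blk ?S)" by (rule inc_in_block[OF i])
  have e: "?e \<in> range (blk ?S)"
    using inc_in_block[OF p] by (simp add: b_prior[OF assms] in_range_blk_iff)
  have f_step: "f (x i) \<le> f (x (i - 1)) + df (x (i - 1)) \<bullet> ?d + Lk i / 2 * (norm ?d)\<^sup>2"
    using block_descent[OF grad Lk_lipschitz[OF i] d] by (simp add: inc_def)
  have "(\<Sum>j\<in>UNIV. h (g (x i $ j))) \<le> (\<Sum>j\<in>UNIV. h (g (x (i - 1) $ j))
      + dh (g (x (i - 1) $ j)) * (g (x i $ j) - g (x (i - 1) $ j)))"
    by (intro sum_mono concave_on_imp_below_tangent_within[OF h_concave _ _ h_deriv]) auto
  also have "\<dots> = (\<Sum>j\<in>UNIV. h (g (x (i - 1) $ j)))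
      + (\<Sum>j\<in>UNIV. dh (g (x (i - 1) $ j)) * (g (x i $ j) - g (x (i - 1) $ j)))"
    by (rule sum.distrib)
  also have "(\<Sum>j\<in>UNIV. dh (g (x (i - 1) $ j)) * (g (x i $ j) - g (x (i - 1) $ j)))
      = (\<Sum>j\<in>?S. dh (g (x (i - 1) $ j)) * (g (x i $ j) - g (x (i - 1) $ j)))"
    using d by (intro sum.mono_neutral_right) (auto simp: in_range_blk_iff inc_def)
  finally have reg_step: "(\<Sum>j\<in>UNIV. h (g (x i $ j))) \<le> (\<Sum>j\<in>UNIV. h (g (x (i - 1) $ j)))
      + (\<Sum>j\<in>?S. dh (g (x (i - 1) $ j)) * (g (x i $ j) - g (x (i - 1) $ j)))" .
  have "- ?d \<in> range (blk ?S)" using d by (simp add: in_range_blk_iff)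
  from optimality[OF assms this]
  have "residual i \<bullet> ?d \<le> lam * (\<Sum>j\<in>?S. dh (g (x (i - 1) $ j)) * (g (x (i - 1) $ j) - g (x i $ j)))"
    by (simp add: inc_def inner_diff_right)
  also have "\<dots> = - (lam * (\<Sum>j\<in>?S. dh (g (x (i - 1) $ j)) * (g (x i $ j) - g (x (i - 1) $ j))))"
    by (simp add: sum_negf[symmetric] algebra_simps flip: mult_minus_right)
  finally have F_step: "F (x i) \<le> F (x (i - 1)) + df (x (i - 1)) \<bullet> ?d - residual i \<bullet> ?d + Lk i / 2 * (norm ?d)\<^sup>2"
    using f_step mult_left_mono[OF reg_step less_imp_le[OF lam_pos]]
    by (simp add: objective_eq_sum_coordinates[OF part] distrib_left)
  have res: "df (x (i - 1)) \<bullet> ?d - residual i \<bullet> ?d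
      = (df (x (i - 1)) - df (trial i)) \<bullet> ?d - 2 * Lk i * (norm ?d)\<^sup>2 + 2 * Lk i * (?e \<bullet> ?d)"
    by (simp add: residual_def inner_diff_left inner_add_left power2_norm_eq_inner algebra_simps)
  have total: "F (x i) \<le> F (x (i - 1)) + (df (x (i - 1)) - df (trial i)) \<bullet> ?d
      + 2 * Lk i * (?e \<bullet> ?d) - 3/2 * energy i"
  proof -
    have "u \<le> v + r + s - 3/2 * (c * n)"
      if "u \<le> v + p - q + c / 2 * n" "p - q = r - 2 * c * n + s" for u v p q r s c n :: real
    proof -
      have "u \<le> v + (r - 2 * c * n + s) + c / 2 * n" using that by linarith
      thus ?thesis by (simp add: algebra_simps)
    qed
    from this[OF F_step res] show ?thesis unfolding energy_def .
  qed
  have "(df (x (i - 1)) - df (trial i)) \<bullet> ?d \<le> norm (blk ?S (df (x (i - 1)) - df (trial i))) * norm ?d"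
    by (subst inner_eq_inner_blk[OF d]) (rule norm_cauchy_schwarz)
  also have "\<dots> \<le> (Lk i * norm ?e) * norm ?d"
    using block_lipschitzD[OF Lk_lipschitz[OF i] e]
    by (intro mult_right_mono) (simp_all add: blk_diff trial_def norm_minus_commute)
  finally have c1: "(df (x (i - 1)) - df (trial i)) \<bullet> ?d \<le> Lk i * norm ?e * norm ?d" .
  have c2: "2 * Lk i * (?e \<bullet> ?d) \<le> 2 * Lk i * (norm ?e * norm ?d)"
    using Lk_pos[OF i] by (intro mult_left_mono norm_cauchy_schwarz) simp
  have "3 * Lk i * norm ?e * norm ?d \<le> 1/4 * energy i + 1/4 * energy (prior i)"
  proof -
    \<comment> \<open>the square roots of the two energies: the mixed term is at most half of their product\<close>
    let ?u = "sqrt (Lk i) * norm ?d" and ?v = "sqrt (Lk (prior i)) * norm (inc (prior i))"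
    have pos: "0 < Lk i" "0 < Lk (prior i)" using Lk_pos i p by auto
    have "Lk i * sqrt (Lk (prior i) / Lk i) = sqrt (Lk i) * sqrt (Lk (prior i))"
      using pos by (simp add: real_sqrt_divide field_simps)
    hence "Lk i * \<beta> i \<le> 1/6 * (sqrt (Lk i) * sqrt (Lk (prior i)))"
      using mult_left_mono[OF beta_bound[OF assms], of "Lk i"] pos by simp
    hence "3 * (Lk i * \<beta> i) * (norm (inc (prior i)) * norm ?d)
        \<le> 3 * (1/6 * (sqrt (Lk i) * sqrt (Lk (prior i)))) * (norm (inc (prior i)) * norm ?d)"
      by (intro mult_right_mono mult_left_mono) auto
    hence "3 * Lk i * norm ?e * norm ?d \<le> 1/2 * (?u * ?v)"
      using beta_nonneg[OF i] by (simp add: algebra_simps)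
    also have "\<dots> \<le> 1/4 * ?u\<^sup>2 + 1/4 * ?v\<^sup>2" using sum_squares_bound[of ?u ?v] by simp
    also have "\<dots> = 1/4 * energy i + 1/4 * energy (prior i)"
      using pos by (simp add: energy_def power_mult_distrib)
    finally show ?thesis .
  qed
  with total c1 c2 show ?thesis by (simp add: algebra_simps)
qed

lemma dist_iterates_le:
  assumes "m \<le> k" "k \<le> M"
  shows "dist (x k) (x m) \<le> (\<Sum>i\<in>{m<..M}. norm (inc i))"
proof -
  have "dist (x k) (x m) \<le> (\<Sum>i\<in>{m<..k}. norm (inc i))"
    using assms(1)
  proof (induction k rule: dec_induct)
    case (step k)
    have "{m<..Suc k} = insert (Suc k) {m<..k}" using step(1) by auto
    moreover have "dist (x (Suc k)) (x m) \<le> norm (inc (Suc k)) + dist (x k) (x m)"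
      using dist_triangle[of "x (Suc k)" "x m" "x k"] by (simp add: inc_def dist_norm)
    ultimately show ?case using step.IH by simp
  qed simp
  also have "\<dots> \<le> (\<Sum>i\<in>{m<..M}. norm (inc i))"
    using assms by (intro sum_mono2) auto
  finally show ?thesis .
qed

definition window :: "nat \<Rightarrow> nat set" where "window n = {n * T<..Suc n * T}"

definition amp :: "nat \<Rightarrow> real" where "amp n = sqrt (\<Sum>i\<in>window n. energy i)"

lemma window_ge_1: "i \<in> window n \<Longrightarrow> 1 \<le> i" and finite_window: "finite (window n)"
  by (auto simp: window_def)

lemma energy_window_nonneg: "i \<in> window n \<Longrightarrow> 0 \<le> energy i"
  using energy_nonneg window_ge_1 by blast

lemma amp_sq: "(amp n)\<^sup>2 = (\<Sum>i\<in>window n. energy i)"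
  unfolding amp_def by (intro real_sqrt_pow2 sum_nonneg energy_window_nonneg)

lemma amp_nonneg: "0 \<le> amp n"
  unfolding amp_def by (intro real_sqrt_ge_zero sum_nonneg energy_window_nonneg)

text \<open>
  The predecessors of the updates in a window are pairwise different and lie in the same or in the
  preceding window. Of the \<open>5/4\<close> gained, the errors consume at most \<open>1/4\<close> in the window itself; what
  is left of them is \<open>1/4\<close> of the energy of the preceding window.
\<close>

lemma window_decrease:
  "(amp (Suc n))\<^sup>2 \<le> F (x (Suc n * T)) - F (x (Suc (Suc n) * T)) + (amp n)\<^sup>2 / 4"
proof -
  define m where "m = Suc n * T"
  have mT: "T \<le> m" by (simp add: m_def)
  have "F (x (m + q)) \<le> F (x m) - 5/4 * (\<Sum>i\<in>{m<..m+q}. energy i) + 1/4 * (\<Sum>i\<in>{m<..m+q}. energy (prior i))" for q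
  proof (induction q)
    case (Suc q)
    have "{m<..m + Suc q} = insert (m + Suc q) {m<..m + q}" by auto
    thus ?case using Suc step_decrease[of "m + Suc q"] mT by (simp add: algebra_simps)
  qed simp
  from this[of T] have dec: "F (x (m + T)) \<le> F (x m) - 5/4 * (amp (Suc n))\<^sup>2
      + 1/4 * (\<Sum>i\<in>window (Suc n). energy (prior i))"
    unfolding amp_sq by (simp add: m_def window_def add.commute)
  have "(\<Sum>i\<in>window (Suc n). energy (prior i)) \<le> (\<Sum>i\<in>window n \<union> window (Suc n). energy i)"
  proof (rule sum_pullback_le_of_inj_on)
    show "inj_on prior (window (Suc n))"
      by (rule inj_on_subset[OF inj_on_prior]) (auto simp: window_def)
    show "prior ` window (Suc n) \<subseteq> window n \<union> window (Suc n)"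
    proof
      fix k assume "k \<in> prior ` window (Suc n)"
      then obtain i where i: "i \<in> window (Suc n)" "k = prior i" by blast
      hence "T < i" by (auto simp: window_def)
      from prior_bounds[OF this] i show "k \<in> window n \<union> window (Suc n)"
        by (auto simp: window_def)
    qed
  qed (auto simp: finite_window intro: energy_window_nonneg)
  also have "\<dots> = (amp n)\<^sup>2 + (amp (Suc n))\<^sup>2"
    unfolding amp_sq by (intro sum.union_disjoint finite_window) (auto simp: window_def)
  finally show ?thesis using dec by (simp add: m_def add.commute)
qed

text \<open>
  The factor that bounds the length of the path within a window by \<open>amp\<close>; it comes from the
  Cauchy-Schwarz inequality for \<open>T\<close> steps and from \<open>l \<le> Lk i\<close>.
\<close>

definition path_const :: real where "path_const = sqrt (T / l)"

lemma sum_norm_inc_le: "(\<Sum>i\<in>window n. norm (inc i)) \<le> path_const * amp n"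
proof (rule power2_le_imp_le)
  have "(\<Sum>i\<in>window n. norm (inc i))\<^sup>2 \<le> (\<Sum>i\<in>window n. (norm (inc i))\<^sup>2) * card (window n)"
    by (rule sum_squared_le_sum_of_squares)
  also have "\<dots> \<le> (\<Sum>i\<in>window n. energy i / l) * T"
  proof (intro mult_mono sum_mono)
    fix i assume "i \<in> window n"
    hence "l * (norm (inc i))\<^sup>2 \<le> energy i"
      unfolding energy_def using Lk_ge[OF window_ge_1] by (intro mult_right_mono) auto
    thus "(norm (inc i))\<^sup>2 \<le> energy i / l" using l_pos by (simp add: field_simps)
  qed (use l_pos in \<open>auto simp: window_def[of n, symmetric] intro!: sum_nonneg divide_nonneg_pos energy_window_nonneg\<close>, simp add: window_def)
  also have "\<dots> = (path_const * amp n)\<^sup>2"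
    unfolding power_mult_distrib amp_sq using l_pos
    by (simp add: path_const_def sum_divide_distrib[symmetric])
  finally show "(\<Sum>i\<in>window n. norm (inc i))\<^sup>2 \<le> (path_const * amp n)\<^sup>2" .
  show "0 \<le> path_const * amp n" using l_pos by (simp add: path_const_def amp_nonneg)
qed

lemma dist_window_le: "n * T \<le> k \<Longrightarrow> k \<le> Suc n * T \<Longrightarrow> dist (x k) (x (n * T)) \<le> path_const * amp n"
  using dist_iterates_le[of "n * T" k "Suc n * T"] sum_norm_inc_le[of n] by (simp add: window_def)

section \<open>Subgradients at the iterates\<close>

text \<open>
  Coordinate \<open>j\<close> has kept its value since the last update \<open>\<kappa>\<close> of its block, so the optimality
  inequality of that update, in the directions along the \<open>j\<close>th axis, is the subgradient inequality
  of \<open>g\<close> at the current value, multiplied by the positive weight.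
\<close>

lemma coordinate_subgradient:
  assumes k: "2 * T \<le> k"
  obtains \<kappa> \<nu> where "k - T < \<kappa>" "\<kappa> \<le> k" "T < \<kappa>" "j \<in> b \<kappa>" "x \<kappa> $ j = x k $ j"
    and "\<And>t. g (x k $ j) + \<nu> * (t - x k $ j) \<le> g t"
    and "lam * dh (g (x (\<kappa> - 1) $ j)) * \<nu> = - residual \<kappa> $ j"
proof -
  obtain S where S: "S \<in> P" "j \<in> S" by (rule coordinate_block)
  define \<kappa> where "\<kappa> = latest S (Suc k)"
  have TS: "T < Suc k" using k by simp
  have \<kappa>: "k - T < \<kappa>" "\<kappa> \<le> k" "T < \<kappa>" and b\<kappa>: "b \<kappa> = S"
    using latest_bounds[OF S(1) TS] b_latest[OF S(1) TS] k T_pos by (auto simp: \<kappa>_def)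
  have xk: "x k $ j = x \<kappa> $ j"
    using latest_max[OF S(1) TS] \<kappa> S by (intro block_constant[where S = S]) (auto simp: \<kappa>_def)
  define w where "w = lam * dh (g (x (\<kappa> - 1) $ j))"
  have w: "0 < w" using lam_pos dh_pos by (simp add: w_def)
  define \<nu> where "\<nu> = - residual \<kappa> $ j / w"
  have "g (x k $ j) + \<nu> * (t - x k $ j) \<le> g t" for t
  proof -
    define s where "s = t - x k $ j"
    define d :: "real ^ 'n" where "d = axis j s"
    have d: "d \<in> range (blk (b \<kappa>))"
      using S by (auto simp: in_range_blk_iff d_def axis_def b\<kappa>)
    have "(\<Sum>i\<in>b \<kappa>. dh (g (x (\<kappa> - 1) $ i)) * (g (x \<kappa> $ i + d $ i) - g (x \<kappa> $ i)))
        = (\<Sum>i\<in>b \<kappa>. if i = j then dh (g (x (\<kappa> - 1) $ j)) * (g t - g (x k $ j)) else 0)"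
      by (intro sum.cong) (auto simp: d_def axis_def s_def xk)
    also have "\<dots> = dh (g (x (\<kappa> - 1) $ j)) * (g t - g (x k $ j))"
      using S by (simp add: b\<kappa>)
    finally have "0 \<le> residual \<kappa> $ j * s + w * (g t - g (x k $ j))"
      using optimality[OF \<kappa>(3) d] by (simp add: d_def inner_axis w_def mult.assoc)
    hence "w * (g (x k $ j) + \<nu> * s) \<le> w * g t"
      using w by (simp add: \<nu>_def algebra_simps)
    thus ?thesis using w by (simp add: s_def)
  qed
  moreover have "lam * dh (g (x (\<kappa> - 1) $ j)) * \<nu> = - residual \<kappa> $ j"
    unfolding w_def[symmetric] \<nu>_def using w by simp
  ultimately show thesis using that \<kappa> S b\<kappa> xk by auto
qed

text \<open>
  The subgradient of \<open>F\<close> built from the \<open>\<nu>\<close> of \<open>coordinate_subgradient\<close> has components that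
  would vanish if gradient and weights had been evaluated at the current iterate. They are
  therefore bounded by the three discrepancies: between \<open>df\<close> at \<open>x k\<close> and at the trial point,
  the proximal term, and between the current weight and the weight used in the update. Each is
  Lipschitz in quantities bounded by the path length \<open>W\<close>. The last update of a block is less than
  \<open>T\<close> iterations old and its predecessor less than \<open>2 * T\<close>, so both belong to the path. As
  \<open>W < \<rho>\<close>, all points involved stay in the ball of radius \<open>4 * \<rho>\<close>.
\<close>

lemma small_subgradient:
  assumes \<rho>: "0 < \<rho>"
    and lip: "\<And>S. S \<in> P \<Longrightarrow> C0-lipschitz_on (ball z (4 * \<rho>)) (\<lambda>y. blk S (df y))"
  obtains C where "0 \<le> C"
    and "\<And>m k W. m + 2 * T \<le> k \<Longrightarrow> W = (\<Sum>i\<in>{m<..k}. norm (inc i)) \<Longrightarrow> W < \<rho> \<Longrightarrow> dist (x k) z < \<rho> \<Longrightarrow>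
      \<exists>v\<in>limiting_subdiff F (x k). norm v \<le> C * W"
proof -
  define R where "R = norm z + 4 * \<rho>"
  have "0 \<le> R" using \<rho> by (simp add: R_def)
  then obtain M where M: "0 \<le> M"
    and g_lip: "\<And>u v. \<bar>u\<bar> \<le> R \<Longrightarrow> \<bar>v\<bar> \<le> R \<Longrightarrow> \<bar>g u - g v\<bar> \<le> M * \<bar>u - v\<bar>"
    and sub_le: "\<And>u \<nu>. \<bar>u\<bar> \<le> R \<Longrightarrow> (\<And>t. g u + \<nu> * (t - u) \<le> g t) \<Longrightarrow> \<bar>\<nu>\<bar> \<le> M"
    using nonneg_convex_locally_lipschitz[OF g_convex g_nonneg] by metis
  have C0: "0 \<le> C0"
  proof -
    obtain S where "S \<in> P" by (rule coordinate_block)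
    from lipschitz_on_nonneg[OF lip[OF this]] show ?thesis .
  qed
  define C1 where "C1 = 2 * C0 + 4 * L + lam * (\<bar>Lh\<bar> * M * M)"
  have L: "0 \<le> L" using l_pos l_le_L by simp
  have C1: "0 \<le> C1" unfolding C1_def using C0 L M lam_pos by (intro add_nonneg_nonneg mult_nonneg_nonneg) auto
  have "\<exists>v\<in>limiting_subdiff F (x k). norm v \<le> CARD('n) * C1 * W"
    if mk: "m + 2 * T \<le> k" and W_def: "W = (\<Sum>i\<in>{m<..k}. norm (inc i))"
      and W_small: "W < \<rho>" and near: "dist (x k) z < \<rho>" for m k W
  proof -
    have k2T: "2 * T \<le> k" using mk by simp
    have dist_m: "dist (x i) (x k) \<le> W" if "m \<le> i" "i \<le> k" for i
    proof -
      have "dist (x k) (x i) \<le> (\<Sum>i\<in>{i<..k}. norm (inc i))"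
        using that by (intro dist_iterates_le) auto
      also have "\<dots> \<le> W" unfolding W_def using that by (intro sum_mono2) auto
      finally show ?thesis by (simp add: dist_commute)
    qed
    have inc_le: "norm (inc i) \<le> W" if "m < i" "i \<le> k" for i
      unfolding W_def using that by (intro member_le_sum) auto
    have W: "0 \<le> W" unfolding W_def by (intro sum_nonneg) simp
    have coord_le: "\<bar>y $ j\<bar> \<le> R" if "y \<in> ball z (4 * \<rho>)" for y j
    proof -
      have "norm y \<le> norm z + dist y z" using norm_triangle_sub[of y z] by (simp add: dist_norm)
      thus ?thesis using that component_le_norm_cart[of y j] by (simp add: R_def dist_commute)
    qed
    have in_ball: "x i \<in> ball z (4 * \<rho>)" if "m \<le> i" "i \<le> k" for i
    proof -
      have "dist (x i) z \<le> dist (x i) (x k) + dist (x k) z" by (rule dist_triangle)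
      thus ?thesis using dist_m[OF that] W_small near \<rho> by (simp add: dist_commute)
    qed
    have "\<exists>\<nu>. (\<forall>t. g (x k $ j) + \<nu> * (t - x k $ j) \<le> g t) \<and>
        \<bar>df (x k) $ j + lam * dh (g (x k $ j)) * \<nu>\<bar> \<le> C1 * W" for j
    proof -
      obtain \<kappa> \<nu> where \<kappa>: "k - T < \<kappa>" "\<kappa> \<le> k" "T < \<kappa>" and j: "j \<in> b \<kappa>" and xj: "x \<kappa> $ j = x k $ j"
        and sub: "\<And>t. g (x k $ j) + \<nu> * (t - x k $ j) \<le> g t"
        and eq: "lam * dh (g (x (\<kappa> - 1) $ j)) * \<nu> = - residual \<kappa> $ j"
        using coordinate_subgradient[OF k2T] by metis
      let ?p = "prior \<kappa>"
      have i: "1 \<le> \<kappa>" using \<kappa> by simp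
      have p: "m < ?p" "?p \<le> k" "m \<le> \<kappa> - 1" "\<kappa> - 1 \<le> k" "m < \<kappa>"
        using prior_bounds[OF \<kappa>(3)] \<kappa> mk by auto
      have ext: "norm (\<beta> \<kappa> *\<^sub>R inc ?p) \<le> W"
        using inc_le[OF p(1,2)] beta_nonneg[OF i] beta_le_1[OF i]
          mult_left_le_one_le[of "norm (inc ?p)" "\<beta> \<kappa>"] by simp
      (* t1, t2 and t3 below bound the gradient, proximal and weight discrepancies by multiples of W;
         the trial point has to be in the ball for the Lipschitz bound on df. *)
      have trial_near: "norm (x k - trial \<kappa>) \<le> 2 * W"
      proof -
        have "norm (x k - trial \<kappa>) = norm ((x k - x (\<kappa> - 1)) - \<beta> \<kappa> *\<^sub>R inc ?p)"
          by (simp add: trial_def diff_diff_eq)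
        also have "\<dots> \<le> norm (x k - x (\<kappa> - 1)) + norm (\<beta> \<kappa> *\<^sub>R inc ?p)" by (rule norm_triangle_ineq4)
        also have "norm (x k - x (\<kappa> - 1)) \<le> W"
          using dist_m[OF p(3,4)] by (simp add: dist_norm norm_minus_commute)
        finally show ?thesis using ext by simp
      qed
      have "dist (trial \<kappa>) z \<le> dist (trial \<kappa>) (x k) + dist (x k) z" by (rule dist_triangle)
      hence trial_ball: "trial \<kappa> \<in> ball z (4 * \<rho>)"
        using trial_near W_small near \<rho> by (simp add: dist_norm norm_minus_commute)
      have "\<bar>(df (x k) - df (trial \<kappa>)) $ j\<bar> = \<bar>(blk (b \<kappa>) (df (x k)) - blk (b \<kappa>) (df (trial \<kappa>))) $ j\<bar>"
        using j by simp
      also have "\<dots> \<le> norm (blk (b \<kappa>) (df (x k)) - blk (b \<kappa>) (df (trial \<kappa>)))"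
        by (rule component_le_norm_cart)
      also have "\<dots> \<le> C0 * norm (x k - trial \<kappa>)"
        using p \<kappa> mk by (intro lipschitz_on_normD[OF lip[OF b_in_P[OF i]]] in_ball trial_ball) auto
      also have "\<dots> \<le> C0 * (2 * W)" using C0 trial_near by (rule mult_left_mono[rotated])
      finally have t1: "\<bar>df (x k) $ j - df (trial \<kappa>) $ j\<bar> \<le> C0 * (2 * W)" by simp
      have "\<bar>(inc \<kappa> - \<beta> \<kappa> *\<^sub>R inc ?p) $ j\<bar> \<le> norm (inc \<kappa> - \<beta> \<kappa> *\<^sub>R inc ?p)"
        by (rule component_le_norm_cart)
      also have "\<dots> \<le> norm (inc \<kappa>) + norm (\<beta> \<kappa> *\<^sub>R inc ?p)" by (rule norm_triangle_ineq4)
      also have "\<dots> \<le> 2 * W" using inc_le[OF p(5) \<kappa>(2)] ext by simp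
      finally have "Lk \<kappa> * \<bar>(inc \<kappa> - \<beta> \<kappa> *\<^sub>R inc ?p) $ j\<bar> \<le> L * (2 * W)"
        using Lk_le[OF i] L by (intro mult_mono) auto
      hence t2: "\<bar>(2 * Lk \<kappa>) * (inc \<kappa> - \<beta> \<kappa> *\<^sub>R inc ?p) $ j\<bar> \<le> 4 * L * W"
        using Lk_pos[OF i] by (simp add: abs_mult)
      have Rj: "\<bar>x k $ j\<bar> \<le> R" "\<bar>x (\<kappa> - 1) $ j\<bar> \<le> R"
        using p \<kappa> mk by (auto intro!: coord_le in_ball simp del: mem_ball)
      have "\<bar>x k $ j - x (\<kappa> - 1) $ j\<bar> \<le> W"
        using component_le_norm_cart[of "inc \<kappa>" j] inc_le[OF p(5) \<kappa>(2)] xj by (simp add: inc_def)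
      hence "\<bar>g (x k $ j) - g (x (\<kappa> - 1) $ j)\<bar> \<le> M * W"
        using g_lip[OF Rj] M by (meson mult_left_mono order_trans)
      hence "\<bar>Lh\<bar> * \<bar>g (x k $ j) - g (x (\<kappa> - 1) $ j)\<bar> \<le> \<bar>Lh\<bar> * (M * W)"
        by (intro mult_left_mono) auto
      moreover have "Lh * \<bar>g (x k $ j) - g (x (\<kappa> - 1) $ j)\<bar>
          \<le> \<bar>Lh\<bar> * \<bar>g (x k $ j) - g (x (\<kappa> - 1) $ j)\<bar>"
        by (intro mult_right_mono) auto
      ultimately have "\<bar>dh (g (x k $ j)) - dh (g (x (\<kappa> - 1) $ j))\<bar> \<le> \<bar>Lh\<bar> * (M * W)"
        using dh_lipschitz[of "x k $ j" "x (\<kappa> - 1) $ j"] by linarith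
      moreover have "\<bar>\<nu>\<bar> \<le> M" using sub_le[OF Rj(1) sub] .
      ultimately have "\<bar>dh (g (x k $ j)) - dh (g (x (\<kappa> - 1) $ j))\<bar> * \<bar>\<nu>\<bar> \<le> \<bar>Lh\<bar> * (M * W) * M"
        using M W by (intro mult_mono) auto
      hence "lam * (\<bar>dh (g (x k $ j)) - dh (g (x (\<kappa> - 1) $ j))\<bar> * \<bar>\<nu>\<bar>) \<le> lam * (\<bar>Lh\<bar> * (M * W) * M)"
        using lam_pos by (intro mult_left_mono) auto
      hence t3: "\<bar>lam * ((dh (g (x k $ j)) - dh (g (x (\<kappa> - 1) $ j))) * \<nu>)\<bar> \<le> lam * (\<bar>Lh\<bar> * M * M) * W"
        using lam_pos by (simp add: abs_mult mult.assoc mult.commute[of W])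
      have "df (x k) $ j + lam * dh (g (x k $ j)) * \<nu>
          = (df (x k) $ j - df (trial \<kappa>) $ j) - (2 * Lk \<kappa>) * (inc \<kappa> - \<beta> \<kappa> *\<^sub>R inc ?p) $ j
            + lam * ((dh (g (x k $ j)) - dh (g (x (\<kappa> - 1) $ j))) * \<nu>)"
      proof -
        have "residual \<kappa> $ j = df (trial \<kappa>) $ j + (2 * Lk \<kappa>) * (inc \<kappa> - \<beta> \<kappa> *\<^sub>R inc ?p) $ j"
          by (simp add: residual_def)
        thus ?thesis using eq by (simp add: algebra_simps)
      qed
      hence "\<bar>df (x k) $ j + lam * dh (g (x k $ j)) * \<nu>\<bar>
          \<le> C0 * (2 * W) + 4 * L * W + lam * (\<bar>Lh\<bar> * M * M) * W"
        using t1 t2 t3 by linarith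
      also have "\<dots> = C1 * W" by (simp add: C1_def algebra_simps)
      finally show ?thesis using sub by blast
    qed
    then obtain \<nu> where \<nu>: "\<And>j t. g (x k $ j) + \<nu> j * (t - x k $ j) \<le> g t"
      and \<nu>_le: "\<And>j. \<bar>df (x k) $ j + lam * dh (g (x k $ j)) * \<nu> j\<bar> \<le> C1 * W"
      by metis
    let ?v = "(\<chi> j. df (x k) $ j + lam * dh (g (x k $ j)) * \<nu> j) :: real ^ 'n"
    have "?v \<in> limiting_subdiff F (x k)"
      using objective_subgradient[where f = f and df = df and x = "x k", OF part grad g_convex g_nonneg h_deriv less_imp_le[OF dh_pos] lam_pos \<nu>]
        frechet_subdiff_subset_limiting by blast
    moreover have "norm ?v \<le> CARD('n) * C1 * W"
    proof -
      have "norm ?v \<le> (\<Sum>j\<in>UNIV. \<bar>?v $ j\<bar>)" by (rule norm_le_l1_cart)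
      also have "\<dots> \<le> (\<Sum>j\<in>(UNIV :: 'n set). C1 * W)" using \<nu>_le by (intro sum_mono) simp
      finally show ?thesis by simp
    qed
    ultimately show ?thesis by blast
  qed
  moreover have "0 \<le> CARD('n) * C1" using C1 by simp
  ultimately show thesis using that by blast
qed

section \<open>Convergence to the limit point\<close>

lemma F_continuous: "continuous_on UNIV F"
  using continuous_on_objective[OF part grad g_convex h_deriv] .

lemma F_decseq: "decseq (\<lambda>k. F (x k))"
proof (rule decseq_SucI)
  show "F (x (Suc k)) \<le> F (x k)" for k using decreasing[of "Suc k"] by simp
qed

lemma F_limit:
  assumes r: "strict_mono r" and lim: "(x \<circ> r) \<longlonglongrightarrow> z"
  shows F_tendsto: "(\<lambda>k. F (x k)) \<longlonglongrightarrow> F z" and F_ge_limit: "F z \<le> F (x k)"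
proof -
  have "((\<lambda>k. F (x k)) \<circ> r) \<longlonglongrightarrow> F z"
    using continuous_on_tendsto_compose[OF F_continuous lim] by (simp add: o_def)
  from decseq_LIMSEQ_of_subseq[OF F_decseq r this]
  show "(\<lambda>k. F (x k)) \<longlonglongrightarrow> F z" "F z \<le> F (x k)" by auto
qed

lemma strict_mono_mult_T: "strict_mono (\<lambda>n. n * T)"
  using T_pos by (intro strict_monoI) simp

lemma amp_tendsto_0:
  assumes r: "strict_mono r" and lim: "(x \<circ> r) \<longlonglongrightarrow> z"
  shows "amp \<longlonglongrightarrow> 0"
proof (rule tendsto_zero_of_contracting_squares)
  show "(amp (Suc n))\<^sup>2 \<le> F (x (Suc n * T)) - F (x (Suc (Suc n) * T)) + (amp n)\<^sup>2 / 4" for n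
    by (rule window_decrease)
  show "(\<lambda>n. F (x (n * T))) \<longlonglongrightarrow> F z"
    using LIMSEQ_subseq_LIMSEQ[OF F_tendsto[OF r lim] strict_mono_mult_T] by (simp add: o_def)
  show "F z \<le> F (x (n * T))" for n by (rule F_ge_limit[OF r lim])
qed

lemma dist_checkpoint: "dist (x k) (x (k div T * T)) \<le> path_const * amp (k div T)"
proof (rule dist_window_le)
  show "k \<le> Suc (k div T) * T"
    using dividend_less_div_times[OF T_pos, of k] by simp
qed simp

lemma le_div_T: "N * T \<le> k \<Longrightarrow> N \<le> k div T"
  using T_pos by (simp add: less_eq_div_iff_mult_less_eq)

text \<open>
  The limit point is given along an arbitrary subsequence. It is also a cluster point of the
  iterates at the ends of the windows, as the path length within a window tends to \<open>0\<close>.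
\<close>

lemma checkpoints_near_limit_point:
  assumes r: "strict_mono r" and lim: "(x \<circ> r) \<longlonglongrightarrow> z" and "0 < e"
  shows "\<exists>\<^sub>F n in sequentially. dist (x (n * T)) z < e"
  unfolding frequently_sequentially
proof
  fix N
  have "(\<lambda>n. path_const * amp n) \<longlonglongrightarrow> path_const * 0"
    by (intro tendsto_mult_left amp_tendsto_0[OF r lim])
  hence "\<forall>\<^sub>F n in sequentially. path_const * amp n < e / 2"
    using \<open>0 < e\<close> by (intro order_tendstoD(2)[of _ 0]) auto
  then obtain N1 where N1: "\<And>n. n \<ge> N1 \<Longrightarrow> path_const * amp n < e / 2"
    unfolding eventually_sequentially by blast
  obtain N2 where N2: "\<And>i. i \<ge> N2 \<Longrightarrow> dist (x (r i)) z < e / 2"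
    using metric_LIMSEQ_D[OF lim, of "e / 2"] \<open>0 < e\<close> by auto
  define i where "i = max N2 (max N N1 * T)"
  let ?n = "r i div T"
  have "max N N1 * T \<le> r i" using seq_suble[OF r, of i] by (simp add: i_def)
  hence n: "max N N1 \<le> ?n" by (rule le_div_T)
  have "dist (x (?n * T)) z \<le> dist (x (r i)) (x (?n * T)) + dist (x (r i)) z"
    by (metis dist_commute dist_triangle)
  also have "\<dots> < e / 2 + e / 2"
    using dist_checkpoint[of "r i"] N1[of ?n] N2[of i] n by (intro add_strict_mono) (auto simp: i_def)
  finally show "\<exists>n\<ge>N. dist (x (n * T)) z < e" using n by auto
qed

text \<open>
  The iterates are observed at the multiples of \<open>T\<close> only, so that the two-step recursion relates
  consecutive windows. The iterates in between follow since windows become short.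
\<close>

lemma iterates_converge:
  assumes r: "strict_mono r" and lim: "(x \<circ> r) \<longlonglongrightarrow> z"
    and KL: "KL_property F z" and \<rho>: "0 < \<rho>"
    and lip: "\<And>S. S \<in> P \<Longrightarrow> C0-lipschitz_on (ball z (4 * \<rho>)) (\<lambda>y. blk S (df y))"
  shows "x \<longlonglongrightarrow> z"
proof (rule KL_property_descent[OF KL])
  fix R \<xi> :: real and \<phi> :: "real \<Rightarrow> real"
  assume R: "0 < R" and \<xi>: "0 < \<xi>"
    and \<phi>_nonneg: "\<And>t. 0 \<le> t \<Longrightarrow> t < \<xi> \<Longrightarrow> 0 \<le> \<phi> t"
    and \<phi>_lim: "\<And>u. u \<longlonglongrightarrow> (0::real) \<Longrightarrow> (\<And>n. 0 \<le> u n) \<Longrightarrow> (\<lambda>n::nat. \<phi> (u n)) \<longlonglongrightarrow> 0"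
    and \<phi>_descent: "\<And>y v s. dist y z < R \<Longrightarrow> v \<in> limiting_subdiff F y \<Longrightarrow> F z \<le> s \<Longrightarrow> s \<le> F y \<Longrightarrow>
      F y < F z + \<xi> \<Longrightarrow>
      \<phi> (s - F z) \<le> \<phi> (F y - F z) \<and> F y - s \<le> norm v * (\<phi> (F y - F z) - \<phi> (s - F z))"
  obtain C where C: "0 \<le> C"
    and small_sub: "\<And>m k W. m + 2 * T \<le> k \<Longrightarrow> W = (\<Sum>i\<in>{m<..k}. norm (inc i)) \<Longrightarrow> W < \<rho> \<Longrightarrow>
      dist (x k) z < \<rho> \<Longrightarrow> \<exists>v\<in>limiting_subdiff F (x k). norm v \<le> C * W"
    by (rule small_subgradient[OF \<rho> lip]) (assumption, rule that)
  define y where "y n = x (n * T)" for n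
  define K where "K = C * path_const"
  have c: "0 \<le> path_const" using l_pos by (simp add: path_const_def)
  have K: "0 \<le> K" using C c by (simp add: K_def)
  define \<psi> where "\<psi> n = 2 * K * \<phi> (F (y n) - F z)" for n
  have gap: "0 \<le> F (y n) - F z" for n using F_ge_limit[OF r lim] by (simp add: y_def)
  have "(\<lambda>n. F (y n)) \<longlonglongrightarrow> F z"
    using LIMSEQ_subseq_LIMSEQ[OF F_tendsto[OF r lim] strict_mono_mult_T]
    by (simp add: o_def y_def)
  hence gap_lim: "(\<lambda>n. F (y n) - F z) \<longlonglongrightarrow> 0" by (simp add: LIM_zero)
  have gap_small: "\<forall>\<^sub>F n in sequentially. F (y n) - F z < \<xi>"
    by (rule order_tendstoD(2)[OF gap_lim \<xi>])
  have amp_lim: "amp \<longlonglongrightarrow> 0" by (rule amp_tendsto_0[OF r lim])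
  have y_lim: "y \<longlonglongrightarrow> z"
  proof (rule tendsto_of_two_step_recursion)
    show "0 \<le> amp n" for n by (rule amp_nonneg)
    show "amp \<longlonglongrightarrow> 0" by (rule amp_lim)
    show "\<forall>\<^sub>F n in sequentially. 0 \<le> \<psi> n"
      using gap_small by eventually_elim (use K gap in \<open>simp add: \<psi>_def \<phi>_nonneg zero_le_mult_iff\<close>)
    have "\<psi> \<longlonglongrightarrow> 2 * K * 0"
      unfolding \<psi>_def by (intro tendsto_mult_left \<phi>_lim gap_lim gap)
    thus "\<psi> \<longlonglongrightarrow> 0" by simp
    show "0 \<le> path_const" by (rule c)
    show "dist (y (Suc n)) (y n) \<le> path_const * amp n" for n
      unfolding y_def by (rule dist_window_le) auto
    show "0 < min R \<rho>" using R \<rho> by simp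
    show "\<exists>\<^sub>F n in sequentially. dist (y n) z < e" if "0 < e" for e
      unfolding y_def by (rule checkpoints_near_limit_point[OF r lim that])
    have "(\<lambda>n. path_const * (amp (n + 1) + amp n)) \<longlonglongrightarrow> path_const * (0 + 0)"
      by (intro tendsto_intros amp_lim LIMSEQ_ignore_initial_segment)
    hence "\<forall>\<^sub>F n in sequentially. path_const * (amp (n + 1) + amp n) < \<rho>"
      using \<rho> by (intro order_tendstoD(2)[of _ 0]) auto
    moreover have "\<forall>\<^sub>F n in sequentially. F (y (n + 2)) - F z < \<xi>"
      using gap_small eventually_sequentially_seg[of "\<lambda>n. F (y n) - F z < \<xi>" 2] by simp
    ultimately show "\<forall>\<^sub>F n in sequentially. dist (y (n + 2)) z < min R \<rho> \<longrightarrow>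
        amp (n + 2) \<le> 5/8 * amp (n + 1) + 1/8 * amp n + \<psi> (n + 2) - \<psi> (n + 3)"
    proof eventually_elim
      case (elim n)
      show ?case
      proof
        assume near: "dist (y (n + 2)) z < min R \<rho>"
        define W where "W = (\<Sum>i\<in>{n * T<..(n + 2) * T}. norm (inc i))"
        have "{n * T<..(n + 2) * T} = window n \<union> window (n + 1)"
          by (auto simp: window_def)
        hence "W = (\<Sum>i\<in>window n. norm (inc i)) + (\<Sum>i\<in>window (n + 1). norm (inc i))"
          unfolding W_def by (simp only:) (intro sum.union_disjoint finite_window, auto simp: window_def)
        hence W_le: "W \<le> path_const * (amp (n + 1) + amp n)"
          using sum_norm_inc_le[of n] sum_norm_inc_le[of "n + 1"] by (simp add: distrib_left)
        have "\<exists>v\<in>limiting_subdiff F (y (n + 2)). norm v \<le> C * W"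
          unfolding y_def
        proof (rule small_sub[OF _ W_def])
          show "n * T + 2 * T \<le> (n + 2) * T" by (simp add: add_mult_distrib)
          show "W < \<rho>" using W_le elim(1) by simp
          show "dist (x ((n + 2) * T)) z < \<rho>" using near unfolding y_def by simp
        qed
        then obtain v where v: "v \<in> limiting_subdiff F (y (n + 2))" "norm v \<le> C * W" by blast
        have "norm v \<le> K * (amp (n + 1) + amp n)"
          using v(2) mult_left_mono[OF W_le C] by (simp add: K_def mult.assoc)
        let ?\<Delta> = "\<phi> (F (y (n + 2)) - F z) - \<phi> (F (y (n + 3)) - F z)"
        have "\<phi> (F (y (n + 3)) - F z) \<le> \<phi> (F (y (n + 2)) - F z) \<and>
            F (y (n + 2)) - F (y (n + 3)) \<le> norm v * ?\<Delta>"
        proof (rule \<phi>_descent)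
          show "F (y (n + 3)) \<le> F (y (n + 2))"
            unfolding y_def by (intro decseqD[OF F_decseq] mult_le_mono1) simp
        qed (use near v gap[of "n + 3"] elim(2) in simp_all)
        hence \<Delta>: "0 \<le> ?\<Delta>" "F (y (n + 2)) - F (y (n + 3)) \<le> norm v * ?\<Delta>" by simp_all
        have drop: "F (y (n + 2)) - F (y (n + 3)) \<le> K * (amp (n + 1) + amp n) * ?\<Delta>"
          using \<Delta>(2) mult_right_mono[OF \<open>norm v \<le> K * (amp (n + 1) + amp n)\<close> \<Delta>(1)] by linarith
        have "(amp (n + 2))\<^sup>2 \<le> F (y (n + 2)) - F (y (n + 3)) + (amp (n + 1))\<^sup>2 / 4"
        proof -
          have "Suc (n + 1) = n + 2" "Suc (n + 2) = n + 3" by simp_all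
          with window_decrease[of "n + 1"] show ?thesis unfolding y_def by (simp only:)
        qed
        hence "amp (n + 2) \<le> 5/8 * amp (n + 1) + 1/8 * amp n + 2 * K * ?\<Delta>"
          by (rule two_step_bound_of_squares[OF _ drop amp_nonneg amp_nonneg K \<Delta>(1)])
        moreover have "\<psi> (n + 2) - \<psi> (n + 3) = 2 * K * ?\<Delta>"
          by (simp only: \<psi>_def right_diff_distrib)
        ultimately show "amp (n + 2) \<le> 5/8 * amp (n + 1) + 1/8 * amp n + \<psi> (n + 2) - \<psi> (n + 3)"
          by linarith
      qed
    qed
  qed
  have div_T: "filterlim (\<lambda>k. k div T) sequentially sequentially"
    unfolding filterlim_at_top
  proof
    fix N
    show "\<forall>\<^sub>F k in sequentially. N \<le> k div T"
      using eventually_ge_at_top[of "N * T"] by eventually_elim (rule le_div_T)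
  qed
  have amp_div: "(\<lambda>k. amp (k div T)) \<longlonglongrightarrow> 0" by (rule filterlim_compose[OF amp_lim div_T])
  have y_div: "(\<lambda>k. dist (y (k div T)) z) \<longlonglongrightarrow> 0"
    by (rule tendsto_dist_iff[THEN iffD1, OF filterlim_compose[OF y_lim div_T]])
  have lim0: "(\<lambda>k. path_const * amp (k div T) + dist (y (k div T)) z) \<longlonglongrightarrow> 0"
    using tendsto_add[OF tendsto_mult_left[OF amp_div, of path_const] y_div] by simp
  have dist_le: "dist (x k) z \<le> path_const * amp (k div T) + dist (y (k div T)) z" for k
  proof -
    have "dist (x k) z \<le> dist (x k) (y (k div T)) + dist (y (k div T)) z" by (rule dist_triangle)
    also have "dist (x k) (y (k div T)) \<le> path_const * amp (k div T)"
      unfolding y_def by (rule dist_checkpoint)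
    finally show ?thesis by simp
  qed
  have "(\<lambda>k. dist (x k) z) \<longlonglongrightarrow> 0"
    by (rule tendsto_sandwich[OF _ _ tendsto_const lim0])
      (intro always_eventually allI zero_le_dist dist_le)+
  thus "x \<longlonglongrightarrow> z" by (rule tendsto_dist_iff[THEN iffD2])
qed

end

theorem theorem3p7:
  fixes P :: "'n::finite set set"
    and f :: "real ^ 'n \<Rightarrow> real" and df :: "real ^ 'n \<Rightarrow> real ^ 'n"
    and g h dh :: "real \<Rightarrow> real"
    and lam l L Lh \<delta> \<rho> :: real
    and L0 :: "'n set \<Rightarrow> real"
    and Lk \<alpha> \<beta> :: "nat \<Rightarrow> real"
    and b :: "nat \<Rightarrow> 'n set"
    and x :: "nat \<Rightarrow> real ^ 'n" and xs :: "real ^ 'n"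
  defines "F \<equiv> objective P f g h lam"
  assumes "partition_on UNIV P"
    and "0 < lam"
    and "smooth_assms P f df l L"
    and "inner_assms g"
    and "outer_assms g h dh Lh"
    and "coercive F"
    and "bpiree P df g dh lam \<alpha> \<beta> b x"
    and "parameter_rule P df l L \<delta> L0 Lk \<alpha> \<beta> b x"
    and "essentially_cyclic P b"
    and "\<forall>k\<ge>1. F (x k) \<le> F (x (k - 1))"
    and "\<exists>r. strict_mono r \<and> (x \<circ> r) \<longlonglongrightarrow> xs"
    and "KL_property F xs"
    and "0 < \<rho>"
    and "\<forall>S\<in>P. \<exists>C. C-lipschitz_on (ball xs (4 * \<rho>)) (\<lambda>y. blk S (df y))"
  shows "x \<longlonglongrightarrow> xs"
proof -
  obtain T where T: "\<And>S k. S \<in> P \<Longrightarrow> 1 \<le> k \<Longrightarrow> \<exists>i\<in>{k..<k + T}. b i = S"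
    using assms(10) unfolding essentially_cyclic_def by blast
  interpret bpiree_iterates P f df g h dh lam l L Lh \<delta> L0 Lk \<alpha> \<beta> b x T
    using assms T unfolding F_def by unfold_locales auto
  obtain r where r: "strict_mono r" "(x \<circ> r) \<longlonglongrightarrow> xs" using assms(12) by blast
  obtain C where C: "\<And>S. S \<in> P \<Longrightarrow> (C S)-lipschitz_on (ball xs (4 * \<rho>)) (\<lambda>y. blk S (df y))"
    using assms(15) by metis
  have "(\<Sum>S\<in>P. \<bar>C S\<bar>)-lipschitz_on (ball xs (4 * \<rho>)) (\<lambda>y. blk S (df y))" if S: "S \<in> P" for S
  proof (rule lipschitz_on_le[OF C[OF S]])
    have "\<bar>C S\<bar> \<le> (\<Sum>S\<in>P. \<bar>C S\<bar>)" using S by (intro member_le_sum) auto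
    thus "C S \<le> (\<Sum>S\<in>P. \<bar>C S\<bar>)" by linarith
  qed
  with iterates_converge[OF r assms(13)[unfolded F_def] assms(14)] show ?thesis by blast
qed

end
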